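(* Let $F\colon[0,\infty)\to\mathbb R$ be such that both $\mathcal R_dF$ and $$f:=(\mathcal F_1\circ\mathcal R_d^\star\circ\mathcal F_d^{-1})[\mathcal R_dF]$$ are slowly increasing functions (the latter meaning that the tempered distribution $f$ on $\mathbb R$ is regular and generated by a slowly increasing function, again denoted by $f$). If $f\in\mathcal C(\mathbb R)$ and $F$ is continuous at $\|z\|$ for some $z\in\mathbb R^d$, then $$F(\|z\|)=\mathbb E_{\xi\sim\mathcal U_{\mathbb S^{d-1}}}\big[f(|\langle z,\xi\rangle|)\big].$$
   Context: $\|\cdot\|$ and $\langle\cdot,\cdot\rangle$ are the Euclidean norm and inner product; $\mathcal U_{\mathbb S^{d-1}}$ is the uniform distribution on the unit sphere $\mathbb S^{d-1}\subset\mathbb R^d$, with surface measure $\omega_{d-1}$. $\mathcal S(\mathbb R^d)$ is the Schwartz space and $\mathcal S'(\mathbb R^d)$ the space of tempered distributions. A distribution $T\in\mathcal S'(\mathbb R^d)$ is radial if $\langle T,\varphi\circ Q\rangle=\langle T,\varphi\rangle$ for all orthogonal $Q$ and $\varphi\in\mathcal S(\mathbb R^d)$; $\mathcal S'_{\mathrm{rad}}(\mathbb R^d)$ is the space of these. A distribution is regular if it is generated by a function $T\in L^1_{\mathrm{loc}}(\mathbb R^d)$ via $\langle T,\varphi\rangle=\int_{\mathbb R^d}T(x)\varphi(x)\,\mathrm dx$, $\varphi\in\mathcal S(\mathbb R^d)$. A function $T\in L^1_{\mathrm{loc}}(\mathbb R^d)$ is slowly increasing if there exist $c,k,R>1$ such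 that $|T(x)|\le c\|x\|^k$ for all $\|x\|>R$; every slowly increasing function generates a regular tempered distribution and is identified with it. Fourier transform: $\mathcal F_d[\varphi](v)=\int_{\mathbb R^d}e^{-2\pi i\langle x,v\rangle}\varphi(x)\,\mathrm dx$ on $\mathcal S(\mathbb R^d)$, and $\langle\mathcal F_dT,\varphi\rangle:=\langle T,\mathcal F_d\varphi\rangle$ on $\mathcal S'(\mathbb R^d)$; $\mathcal F_d^{-1}$ is its inverse. Rotation operator: $\mathcal R_dF(x):=F(\|x\|)$, $x\in\mathbb R^d$, for $F\colon[0,\infty)\to\mathbb R$ or $F$ an even function on $\mathbb R$. For $\psi\in\mathcal S(\mathbb R)$, $\mathcal A_1\psi(r):=\frac12(\psi(r)+\psi(-r))$. The operator $\mathcal R_d^\star\colon\mathcal S'(\mathbb R^d)\to\mathcal S'_{\mathrm{rad}}(\mathbb R)$ is defined by $\langle\mathcal R_d^\star T,\psi\rangle:=\langle T,(\mathcal R_d\circ\mathcal A_1)\psi\rangle$ for all $\psi\in\mathcal S(\mathbb R)$. *)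

theory Defs
  imports "HOL-Probability.Probability"
begin

section \<open>The Schwartz space\<close>

definition iter_partial ::
    "'a::euclidean_space list \<Rightarrow> ('a \<Rightarrow> complex) \<Rightarrow> 'a \<Rightarrow> complex" where
  "iter_partial bs \<phi> = foldr (\<lambda>b g x. frechet_derivative g (at x) b) bs \<phi>"

text \<open>
  Lists of basis vectors play the role of multi-indices. A function is smooth iff all of its
  iterated partial derivatives exist and are totally differentiable.
\<close>

definition smooth :: "('a::euclidean_space \<Rightarrow> complex) \<Rightarrow> bool" where
  "smooth \<phi> \<longleftrightarrow> (\<forall>bs. set bs \<subseteq> Basis \<longrightarrow> (\<forall>x. iter_partial bs \<phi> differentiable at x))"

definition schwartz :: "('a::euclidean_space \<Rightarrow> complex) set" where
  "schwartz = {\<phi>. smooth \<phi> \<and>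
     (\<forall>k bs. set bs \<subseteq> Basis \<longrightarrow> bounded (range (\<lambda>x. norm x ^ k *\<^sub>R iter_partial bs \<phi> x)))}"

definition schwartz_tendsto ::
    "(nat \<Rightarrow> 'a::euclidean_space \<Rightarrow> complex) \<Rightarrow> ('a \<Rightarrow> complex) \<Rightarrow> bool" where
  "schwartz_tendsto \<Phi> \<phi> \<longleftrightarrow>
     (\<forall>k bs. set bs \<subseteq> Basis \<longrightarrow>
        uniform_limit UNIV (\<lambda>n x. norm x ^ k *\<^sub>R iter_partial bs (\<Phi> n) x)
          (\<lambda>x. norm x ^ k *\<^sub>R iter_partial bs \<phi> x) sequentially)"

section \<open>Tempered distributions\<close>

text \<open>
  Functionals on the Schwartz space are total functions, made extensional so that equality of
  distributions is HOL equality. The Schwartz space is metrizable, so sequential continuity is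
  continuity.
\<close>

definition tempered :: "(('a::euclidean_space \<Rightarrow> complex) \<Rightarrow> complex) set" where
  "tempered = {T \<in> extensional schwartz.
     (\<forall>\<phi>\<in>schwartz. \<forall>\<psi>\<in>schwartz. T (\<lambda>x. \<phi> x + \<psi> x) = T \<phi> + T \<psi>) \<and>
     (\<forall>a. \<forall>\<phi>\<in>schwartz. T (\<lambda>x. a * \<phi> x) = a * T \<phi>) \<and>
     (\<forall>\<Phi>. \<forall>\<phi>\<in>schwartz. range \<Phi> \<subseteq> schwartz \<longrightarrow> schwartz_tendsto \<Phi> \<phi> \<longrightarrow>
        (\<lambda>n. T (\<Phi> n)) \<longlonglongrightarrow> T \<phi>)}"

definition locally_integrable ::
    "('a::euclidean_space \<Rightarrow> 'b::{banach, second_countable_topology}) \<Rightarrow> bool" where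
  "locally_integrable T \<longleftrightarrow> (\<forall>K. compact K \<longrightarrow> set_integrable lebesgue K T)"

definition slowly_increasing ::
    "('a::euclidean_space \<Rightarrow> 'b::{banach, second_countable_topology}) \<Rightarrow> bool" where
  "slowly_increasing T \<longleftrightarrow> locally_integrable T \<and>
     (\<exists>c k R :: real. c > 1 \<and> k > 1 \<and> R > 1 \<and>
        (\<forall>x. norm x > R \<longrightarrow> norm (T x) \<le> c * norm x powr k))"

definition regular_dist ::
    "('a::euclidean_space \<Rightarrow> complex) \<Rightarrow> ('a \<Rightarrow> complex) \<Rightarrow> complex" where
  "regular_dist T = (\<lambda>\<phi>\<in>schwartz. LINT x|lebesgue. T x * \<phi> x)"

section \<open>Fourier transform\<close>

definition fourier :: "('a::euclidean_space \<Rightarrow> complex) \<Rightarrow> 'a \<Rightarrow> complex" where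
  "fourier \<phi> v = (LINT x|lborel. exp (- 2 * of_real pi * \<i> * of_real (x \<bullet> v)) * \<phi> x)"

definition fourier_dist ::
    "(('a::euclidean_space \<Rightarrow> complex) \<Rightarrow> complex) \<Rightarrow> ('a \<Rightarrow> complex) \<Rightarrow> complex" where
  "fourier_dist T = (\<lambda>\<phi>\<in>schwartz. T (fourier \<phi>))"

definition inv_fourier_dist ::
    "(('a::euclidean_space \<Rightarrow> complex) \<Rightarrow> complex) \<Rightarrow> ('a \<Rightarrow> complex) \<Rightarrow> complex" where
  "inv_fourier_dist = inv_into tempered fourier_dist"

section \<open>Rotation operator and its dual\<close>

definition rotation :: "(real \<Rightarrow> 'b) \<Rightarrow> 'a::real_normed_vector \<Rightarrow> 'b" where
  "rotation F x = F (norm x)"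

definition even_part :: "(real \<Rightarrow> complex) \<Rightarrow> real \<Rightarrow> complex" where
  "even_part \<psi> r = (\<psi> r + \<psi> (- r)) / 2"

definition rotation_dual ::
    "(('a::euclidean_space \<Rightarrow> complex) \<Rightarrow> complex) \<Rightarrow> (real \<Rightarrow> complex) \<Rightarrow> complex" where
  "rotation_dual T = (\<lambda>\<psi>\<in>schwartz. T (rotation (even_part \<psi>)))"

section \<open>Uniform distribution on the unit sphere\<close>

text \<open>
  The surface measure of a Borel set \<open>A\<close> of the sphere is \<open>d\<close> times the Lebesgue measure of the
  cone \<open>{x. 0 < norm x < 1 \<and> x / norm x \<in> A}\<close>; here \<open>sgn x = x / norm x\<close>. In dimension one
  this is the counting measure on the two-point sphere.
\<close>

definition surface_measure :: "'a::euclidean_space measure" where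
  "surface_measure = scale_measure (of_nat DIM('a))
     (distr (restrict_space lborel (ball 0 1 - {0})) (restrict_space borel (sphere 0 1)) sgn)"

definition uniform_sphere :: "'a::euclidean_space measure" where
  "uniform_sphere = uniform_measure surface_measure (sphere 0 1)"

lemma sgn_measurable_sphere:
  "sgn \<in> restrict_space lborel (ball 0 1 - {0 :: 'a::euclidean_space})
     \<rightarrow>\<^sub>M restrict_space borel (sphere 0 1)"
proof (rule measurable_restrict_space2)
  show "sgn \<in> space (restrict_space lborel (ball 0 1 - {0 :: 'a})) \<rightarrow> sphere 0 1"
    by (auto simp: space_restrict_space norm_sgn)
  have "sgn \<in> borel_measurable (borel :: 'a measure)"
    unfolding sgn_div_norm[abs_def] by measurable
  thus "sgn \<in> borel_measurable (restrict_space lborel (ball 0 1 - {0 :: 'a}))"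
    by (intro measurable_restrict_space1) simp
qed

lemma emeasure_surface_measure:
  assumes "A \<in> sets borel" "A \<subseteq> sphere 0 (1::real)"
  shows "emeasure surface_measure (A :: 'a::euclidean_space set) =
    of_nat DIM('a) * emeasure lborel {x \<in> ball 0 1 - {0}. sgn x \<in> A}"
proof -
  have A: "A \<in> sets (restrict_space borel (sphere 0 1))"
    using assms by (auto simp: sets_restrict_space_iff)
  have "sgn -` A \<inter> space (restrict_space lborel (ball 0 1 - {0 :: 'a}))
      = {x \<in> ball 0 1 - {0}. sgn x \<in> A}"
    by (auto simp: space_restrict_space)
  thus ?thesis
    unfolding surface_measure_def
    by (subst emeasure_scale_measure, subst emeasure_distr[OF sgn_measurable_sphere A],
        subst emeasure_restrict_space) auto
qed

lemma prob_space_uniform_sphere: "prob_space (uniform_sphere :: 'a::euclidean_space measure)"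
proof -
  have "{x \<in> ball 0 1 - {0}. sgn x \<in> sphere 0 1} = ball 0 1 - {0 :: 'a}"
    by (auto simp: norm_sgn)
  moreover have "emeasure lborel (ball 0 1 - {0 :: 'a}) = emeasure lborel (ball 0 1 :: 'a set)"
    by (rule emeasure_Diff_null_set) auto
  ultimately have "emeasure surface_measure (sphere 0 1 :: 'a set) =
      of_nat DIM('a) * emeasure lborel (ball 0 1 :: 'a set)"
    by (subst emeasure_surface_measure) auto
  moreover have "emeasure lborel (ball 0 1 :: 'a set) \<noteq> 0"
    using emeasure_lborel_ball_finite[of 0 1] content_ball_pos[of 1 "0::'a"]
    by (auto simp: measure_def)
  moreover have "emeasure lborel (ball 0 1 :: 'a set) < \<infinity>"
    by (rule emeasure_lborel_ball_finite)
  ultimately show ?thesis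
    unfolding uniform_sphere_def
    by (intro prob_space_uniform_measure) (auto simp: ennreal_mult_eq_top_iff)
qed

end

theory Submission
  imports Defs
begin

text \<open>
  The hypothesis is tested only against the Gaussians \<open>exp (- pi * a * t^2)\<close> and their multiples by
  \<open>t\<close>. Both the one-dimensional and the \<open>d\<close>-dimensional Fourier transform send Gaussians to Gaussians,
  so the relation between \<open>F\<close> and \<open>f\<close> becomes: the integral of \<open>f t * exp (- pi * a * t^2)\<close> over the
  line is \<open>sqrt a ^ (d - 1)\<close> times the integral of \<open>F (norm x) * exp (- pi * a * norm x ^ 2)\<close> over the
  space, for all \<open>a > 0\<close>; the odd test functions force \<open>f\<close> to be even. By rotation invariance of the
  Lebesgue measure, the spherical mean of \<open>f\<close> has the same Gaussian integrals as the radial function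
  of \<open>F\<close>. In the variable \<open>u = exp (- pi * norm x ^ 2)\<close> these integrals are moments, so by the
  Weierstrass theorem the two radial functions agree wherever both are continuous.

  The inverse Fourier transform in the hypothesis is meaningful only if the regular distribution lies
  in the range of the Fourier transform. Since the radial function is even, its own Fourier transform
  is a preimage, by Fourier inversion on the Schwartz space.
\<close>

section \<open>Slowly increasing and rapidly decreasing functions\<close>

text \<open>For a general Schwartz function \<psi>, smoothness of
  \<open>rotation (even_part \<psi>)\<close> at the origin is a theorem of its own. For a Gaussian
  everything is explicit: the one- and the d-dimensional transforms of \<open>gaussian a\<close> are
  both multiples of \<open>gaussian (1 / a)\<close> and differ only in the power of
  \<open>sqrt a\<close>. That discrepancy is the factor \<open>sqrt a ^ (d - 1)\<close>. It cancels
  later: when \<open>f (x \<bullet> \<xi>)\<close> is integrated over the space against a Gaussian,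
  each of the d - 1 coordinates orthogonal to \<xi> contributes \<open>1 / sqrt a\<close>.

  Evenness of \<open>f\<close> enters because the mean that is computed contains
  \<open>x \<bullet> \<xi>\<close>, while the theorem has its absolute value.

  The quantitative decay bounds in the first half serve two ends: they keep \<open>fourier\<close>
  inside \<open>schwartz\<close>, and they make the preimage under \<open>fourier_dist\<close>
  sequentially continuous, hence a member of \<open>tempered\<close>.\<close>

lemma integral_prod_Basis:
  fixes g :: "'a::euclidean_space \<Rightarrow> real \<Rightarrow> 'b::{real_normed_field,banach,second_countable_topology}"
  assumes "\<And>b. b \<in> Basis \<Longrightarrow> integrable lborel (g b)"
  shows "integrable lborel (\<lambda>x. \<Prod>b\<in>Basis. g b (x \<bullet> b))"
    and "(LINT x|lborel. (\<Prod>b\<in>Basis. g b (x \<bullet> b))) = (\<Prod>b\<in>Basis. (LINT t|lborel. g b t))"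
proof -
  interpret product_sigma_finite "\<lambda>_::'a. lborel :: real measure" ..
  have [measurable]: "g b \<in> borel_measurable borel" if "b \<in> Basis" for b
    using assms[OF that] by simp
  have meas2: "(\<lambda>x. \<Prod>b\<in>Basis. g b (x \<bullet> b)) \<in> borel_measurable borel"
    by (intro borel_measurable_prod) measurable
  have meas1: "(\<lambda>f. \<Sum>b\<in>Basis. f b *\<^sub>R b) \<in> measurable (\<Pi>\<^sub>M b\<in>(Basis::'a set). lborel) borel"
    by measurable
  have eq: "(\<Prod>b\<in>Basis. g b ((\<Sum>b\<in>Basis. f b *\<^sub>R b) \<bullet> b)) = (\<Prod>b\<in>Basis. g b (f b))" for f
    by (intro prod.cong refl) simp
  have "integrable (distr (\<Pi>\<^sub>M b\<in>(Basis::'a set). lborel) borel (\<lambda>f. \<Sum>b\<in>Basis. f b *\<^sub>R b))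
      (\<lambda>x. \<Prod>b\<in>Basis. g b (x \<bullet> b))"
    unfolding integrable_distr_eq[OF meas1 meas2] eq
    using assms by (intro product_integrable_prod) auto
  then show "integrable lborel (\<lambda>x. \<Prod>b\<in>Basis. g b (x \<bullet> b))"
    by (simp only: lborel_eq[where 'a='a])
  have "integral\<^sup>L (distr (\<Pi>\<^sub>M b\<in>(Basis::'a set). lborel) borel (\<lambda>f. \<Sum>b\<in>Basis. f b *\<^sub>R b))
      (\<lambda>x. \<Prod>b\<in>Basis. g b (x \<bullet> b)) = (\<Prod>b\<in>Basis. (LINT t|lborel. g b t))"
    unfolding integral_distr[OF meas1 meas2] eq
    using assms by (intro product_integral_prod) auto
  then show "(LINT x|lborel. (\<Prod>b\<in>Basis. g b (x \<bullet> b))) = (\<Prod>b\<in>Basis. (LINT t|lborel. g b t))"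
    by (simp only: lborel_eq[where 'a='a])
qed

lemma one_plus_power_le:
  fixes u :: real
  assumes "0 \<le> u"
  shows "(1 + u) ^ n \<le> 2 ^ n * (1 + u ^ n)"
proof -
  have "1 + u \<le> 2 * max 1 u"
    by auto
  then have "(1 + u) ^ n \<le> (2 * max 1 u) ^ n"
    using assms by (intro power_mono) auto
  also have "\<dots> = 2 ^ n * max 1 u ^ n"
    by (rule power_mult_distrib)
  also have "max 1 u ^ n \<le> 1 + u ^ n"
    using assms by (auto simp: max_def)
  finally show ?thesis
    by simp
qed

text \<open>The exponent is twice the dimension because the product of the d factors
  \<open>1 + (x \<bullet> b)\<^sup>2\<close> is at most
  \<open>2 ^ d * (1 + norm x ^ (2 * d))\<close>. The weight is therefore dominated by a product of
  one-dimensional functions 1 / (1 + t^2), each integrable.\<close>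

lemma integrable_inverse_weight:
  "integrable lborel (\<lambda>x::'a::euclidean_space. inverse (1 + norm x ^ (2 * DIM('a))))"
proof -
  have 1: "integrable lborel (\<lambda>t::real. inverse (1 + t\<^sup>2))"
    using integrable_inverse_1_plus_square by (simp add: set_integrable_def)
  have "integrable lborel (\<lambda>x::'a. 2 ^ DIM('a) * (\<Prod>b\<in>Basis. inverse (1 + (x \<bullet> b)\<^sup>2)))"
    using integral_prod_Basis(1)[of "\<lambda>_ t. inverse (1 + t\<^sup>2)"] 1 by simp
  then show ?thesis
  proof (rule Bochner_Integration.integrable_bound)
    show "AE x in lborel. norm (inverse (1 + norm (x::'a) ^ (2 * DIM('a))))
        \<le> norm (2 ^ DIM('a) * (\<Prod>b\<in>Basis. inverse (1 + (x \<bullet> b)\<^sup>2)))"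
    proof (rule AE_I2)
      fix x :: 'a
      have "(\<Prod>b\<in>(Basis::'a set). 1 + (x \<bullet> b)\<^sup>2) \<le> (\<Prod>b\<in>(Basis::'a set). 1 + (norm x)\<^sup>2)"
        by (intro prod_mono) (auto simp: Basis_le_norm abs_le_square_iff[symmetric])
      also have "\<dots> = (1 + (norm x)\<^sup>2) ^ DIM('a)"
        by simp
      also have "\<dots> \<le> 2 ^ DIM('a) * (1 + norm x ^ (2 * DIM('a)))"
        using one_plus_power_le[of "(norm x)\<^sup>2" "DIM('a)"] by (simp add: power_mult)
      finally have "inverse (2 ^ DIM('a) * (1 + norm x ^ (2 * DIM('a)))) \<le> inverse (\<Prod>b\<in>Basis. 1 + (x \<bullet> b)\<^sup>2)"
        by (intro le_imp_inverse_le) (auto intro!: prod_pos add_pos_nonneg)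
      then have "2 ^ DIM('a) * inverse (2 ^ DIM('a) * (1 + norm x ^ (2 * DIM('a))))
          \<le> 2 ^ DIM('a) * (\<Prod>b\<in>Basis. inverse (1 + (x \<bullet> b)\<^sup>2))"
        unfolding prod_inversef[unfolded o_def] by (intro mult_left_mono) auto
      moreover have "2 ^ DIM('a) * inverse (2 ^ DIM('a) * (1 + norm x ^ (2 * DIM('a)))) = inverse (1 + norm x ^ (2 * DIM('a)))"
        by (simp add: mult.assoc[symmetric])
      ultimately have "inverse (1 + norm x ^ (2 * DIM('a))) \<le> 2 ^ DIM('a) * (\<Prod>b\<in>Basis. inverse (1 + (x \<bullet> b)\<^sup>2))"
        by argo
      then show "norm (inverse (1 + norm x ^ (2 * DIM('a))))
          \<le> norm (2 ^ DIM('a) * (\<Prod>b\<in>Basis. inverse (1 + (x \<bullet> b)\<^sup>2)))"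
        by (simp add: abs_prod)
    qed
  qed simp
qed

text \<open>The decay half of the Schwartz condition, without derivatives, so that it can be stated
  for a single partial derivative or for a product with a bounded factor.\<close>

definition rapidly_decreasing :: "('a::real_normed_vector \<Rightarrow> 'b::real_normed_vector) \<Rightarrow> bool" where
  "rapidly_decreasing g \<longleftrightarrow> (\<forall>k. \<exists>C. \<forall>x. norm x ^ k * norm (g x) \<le> C)"

lemma rapidly_decreasing_iff_bounded:
  "rapidly_decreasing g \<longleftrightarrow> (\<forall>k. bounded (range (\<lambda>x. norm x ^ k *\<^sub>R g x)))"
  unfolding rapidly_decreasing_def by (auto simp: bounded_iff)

lemma rapidly_decreasing_weight:
  assumes "rapidly_decreasing g"
  obtains C where "\<And>x. (1 + norm x ^ m) * norm (g x) \<le> C"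
proof -
  obtain C1 C2 where 1: "\<And>x. norm x ^ 0 * norm (g x) \<le> C1" and 2: "\<And>x. norm x ^ m * norm (g x) \<le> C2"
    using assms unfolding rapidly_decreasing_def by metis
  show thesis
    by (rule that[of "C1 + C2"]) (use add_mono[OF 1 2] in \<open>simp add: algebra_simps\<close>)
qed

lemma rapidly_decreasing_power:
  assumes "rapidly_decreasing g"
  shows "rapidly_decreasing (\<lambda>x. norm x ^ m *\<^sub>R g x)"
  unfolding rapidly_decreasing_def
proof
  fix k
  from assms obtain C where "\<And>x. norm x ^ (k + m) * norm (g x) \<le> C"
    unfolding rapidly_decreasing_def by metis
  then show "\<exists>C. \<forall>x. norm x ^ k * norm (norm x ^ m *\<^sub>R g x) \<le> C"
    by (auto simp: power_add mult.assoc)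
qed

lemma rapidly_decreasing_bound:
  assumes "rapidly_decreasing g" "\<And>x. norm (h x) \<le> c * norm (g x)" "0 \<le> c"
  shows "rapidly_decreasing h"
  unfolding rapidly_decreasing_def
proof
  fix k
  from assms(1) obtain C where C: "\<And>x. norm x ^ k * norm (g x) \<le> C"
    unfolding rapidly_decreasing_def by metis
  have "norm x ^ k * norm (h x) \<le> c * C" for x
    using mult_left_mono[OF assms(2)[of x], of "norm x ^ k"] mult_left_mono[OF C[of x] assms(3)]
    by (simp add: mult_ac)
  then show "\<exists>C. \<forall>x. norm x ^ k * norm (h x) \<le> C"
    by blast
qed

lemma rapidly_decreasing_add:
  assumes "rapidly_decreasing g" "rapidly_decreasing h"
  shows "rapidly_decreasing (\<lambda>x. g x + h x)"
  unfolding rapidly_decreasing_def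
proof
  fix k
  from assms obtain C D where "\<And>x. norm x ^ k * norm (g x) \<le> C" "\<And>x. norm x ^ k * norm (h x) \<le> D"
    unfolding rapidly_decreasing_def by metis
  then have "norm x ^ k * norm (g x + h x) \<le> C + D" for x
    using mult_left_mono[OF norm_triangle_ineq[of "g x" "h x"], of "norm x ^ k"]
    by (smt (verit) distrib_left norm_ge_zero zero_le_power)
  then show "\<exists>C. \<forall>x. norm x ^ k * norm (g x + h x) \<le> C"
    by blast
qed

lemma integrable_rapidly_decreasing:
  fixes g :: "'a::euclidean_space \<Rightarrow> 'b::{banach, second_countable_topology}"
  assumes "rapidly_decreasing g" "g \<in> borel_measurable borel"
  shows "integrable lborel g"
proof -
  obtain C where C: "\<And>x. (1 + norm x ^ (2 * DIM('a))) * norm (g x) \<le> C"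
    using rapidly_decreasing_weight[OF assms(1)] by metis
  show ?thesis
  proof (rule Bochner_Integration.integrable_bound)
    show "integrable lborel (\<lambda>x::'a. C * inverse (1 + norm x ^ (2 * DIM('a))))"
      using integrable_inverse_weight[where 'a='a] by simp
    show "AE x in lborel. norm (g x) \<le> norm (C * inverse (1 + norm x ^ (2 * DIM('a))))"
    proof (rule AE_I2)
      fix x :: 'a
      have "0 < 1 + norm x ^ (2 * DIM('a))"
        by (simp add: add_pos_nonneg)
      with C[of x] have "norm (g x) \<le> C * inverse (1 + norm x ^ (2 * DIM('a)))"
        by (simp add: field_simps)
      then show "norm (g x) \<le> norm (C * inverse (1 + norm x ^ (2 * DIM('a))))"
        by simp
    qed
  qed (use assms in simp)
qed

text \<open>Local integrability takes care of a ball. Outside it the growth is at most a power n,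
  and 2d further powers in the weight leave an integrable tail, which explains the choice of
  \<open>m\<close>.\<close>

lemma slowly_increasing_weight:
  fixes T :: "'a::euclidean_space \<Rightarrow> 'b::{banach, second_countable_topology}"
  assumes "slowly_increasing T"
  obtains m where "integrable lebesgue (\<lambda>x. norm (T x) * inverse (1 + norm x ^ m))"
    and "T \<in> borel_measurable lebesgue"
proof -
  obtain c k R :: real where ckR: "c > 1" "R > 1" "\<And>x. norm x > R \<Longrightarrow> norm (T x) \<le> c * norm x powr k"
    using assms unfolding slowly_increasing_def by blast
  have loc: "set_integrable lebesgue K T" if "compact K" for K
    using assms that unfolding slowly_increasing_def locally_integrable_def by blast
  \<comment> \<open>Local integrability yields measurability only of the restrictions to balls;
    \<open>T\<close> is their pointwise limit.\<close>
  have meas[measurable]: "T \<in> borel_measurable lebesgue"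
  proof (rule borel_measurable_LIMSEQ_metric)
    show "(\<lambda>x. indicator (cball 0 (real n)) x *\<^sub>R T x) \<in> borel_measurable lebesgue" for n
      using loc[of "cball 0 (real n)"] unfolding set_integrable_def by auto
    fix x :: 'a
    obtain N :: nat where "norm x \<le> real N"
      using real_arch_simple by blast
    then have "\<forall>\<^sub>F n in sequentially. indicator (cball 0 (real n)) x *\<^sub>R T x = T x"
      by (intro eventually_sequentiallyI[of N]) (auto simp: indicator_def)
    then show "(\<lambda>n. indicator (cball 0 (real n)) x *\<^sub>R T x) \<longlonglongrightarrow> T x"
      by (rule tendsto_eventually)
  qed
  define n where "n = nat \<lceil>k\<rceil>"
  define m where "m = n + 2 * DIM('a)"
  have n: "norm x powr k \<le> norm x ^ n" if "norm x > R" for x :: 'a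
  proof -
    have "norm x powr k \<le> norm x powr real n"
      using that ckR by (intro powr_mono) (auto simp: n_def intro: real_nat_ceiling_ge)
    moreover have "0 < norm x"
      using that ckR by linarith
    ultimately show ?thesis
      using powr_realpow[of "norm x" n] by metis
  qed
  have i1: "integrable lebesgue (\<lambda>x. indicator (cball 0 R) x * norm (T x))"
    using integrable_norm[OF loc[of "cball 0 R", unfolded set_integrable_def]] by simp
  \<comment> \<open>The factor 2 comes from
    \<open>norm x ^ n * (1 + norm x ^ (2 * d)) \<le> 2 * norm x ^ m\<close>, valid once
    \<open>norm x > 1\<close>.\<close>
  have i2: "integrable lebesgue (\<lambda>x::'a. 2 * c * inverse (1 + norm x ^ (2 * DIM('a))))"
    using integrable_inverse_weight[where 'a='a]
    by (subst integrable_completion) auto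
  have "integrable lebesgue (\<lambda>x. norm (T x) * inverse (1 + norm x ^ m))"
  proof (rule Bochner_Integration.integrable_bound[OF Bochner_Integration.integrable_add[OF i1 i2]])
    have [measurable]: "(\<lambda>x::'a. inverse (1 + norm x ^ m)) \<in> borel_measurable lebesgue"
      by (rule measurable_completion) simp
    show "(\<lambda>x. norm (T x) * inverse (1 + norm x ^ m)) \<in> borel_measurable lebesgue"
      by measurable
    show "AE x in lebesgue. norm (norm (T x) * inverse (1 + norm x ^ m))
       \<le> norm (indicator (cball 0 R) x * norm (T x) + 2 * c * inverse (1 + norm x ^ (2 * DIM('a))))"
    proof (rule AE_I2)
      fix x :: 'a
      have pos: "0 < 1 + norm x ^ m" "0 < 1 + norm x ^ (2 * DIM('a))" for m
        by (simp_all add: add_pos_nonneg)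
      have "norm (T x) * inverse (1 + norm x ^ m)
          \<le> indicator (cball 0 R) x * norm (T x) + 2 * c * inverse (1 + norm x ^ (2 * DIM('a)))"
      proof (cases "norm x \<le> R")
        case True
        have "norm (T x) * inverse (1 + norm x ^ m) \<le> norm (T x)"
          using pos(1)[of m] by (simp add: field_simps)
        moreover have "0 \<le> 2 * c * inverse (1 + norm x ^ (2 * DIM('a)))"
          using ckR pos(2) by simp
        ultimately show ?thesis
          using True by simp
      next
        case False
        then have x1: "norm x > 1" "norm x > R"
          using ckR by auto
        have "norm (T x) \<le> c * norm x ^ n"
          using ckR(3)[OF x1(2)] mult_left_mono[OF n[OF x1(2)], of c] ckR(1) by linarith
        then have "norm (T x) * (1 + norm x ^ (2 * DIM('a))) \<le> c * norm x ^ n * (1 + norm x ^ (2 * DIM('a)))"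
          using pos(2) by (intro mult_right_mono) auto
        also have "\<dots> = c * (norm x ^ n + norm x ^ m)"
          by (simp add: m_def power_add algebra_simps)
        also have "norm x ^ n \<le> norm x ^ m"
          using x1 by (intro power_increasing) (auto simp: m_def)
        finally have "norm (T x) * (1 + norm x ^ (2 * DIM('a))) \<le> 2 * c * (1 + norm x ^ m)"
          using ckR(1) by (simp add: algebra_simps)
        then show ?thesis
          using pos(1)[of m] pos(2) False by (simp add: field_simps)
      qed
      moreover have "0 \<le> norm (T x) * inverse (1 + norm x ^ m)"
        using pos(1)[of m] by simp
      ultimately show "norm (norm (T x) * inverse (1 + norm x ^ m))
         \<le> norm (indicator (cball 0 R) x * norm (T x) + 2 * c * inverse (1 + norm x ^ (2 * DIM('a))))"
        by simp
    qed
  qed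
  with meas that show thesis
    by blast
qed

text \<open>The bound is linear in a weighted supremum of \<open>g\<close>. This is the estimate
  behind the continuity of the functional that \<open>T\<close> induces on test functions.\<close>

lemma slowly_increasing_mult_bound:
  fixes T g :: "'a::euclidean_space \<Rightarrow> complex"
  assumes T: "integrable lebesgue (\<lambda>x. norm (T x) * inverse (1 + norm x ^ m))" "T \<in> borel_measurable lebesgue"
    and g: "g \<in> borel_measurable borel" "\<And>x. (1 + norm x ^ m) * norm (g x) \<le> C"
  shows "integrable lebesgue (\<lambda>x. T x * g x)"
    and "norm (LINT x|lebesgue. T x * g x) \<le> C * (LINT x|lebesgue. norm (T x) * inverse (1 + norm x ^ m))"
proof -
  have pos: "0 < 1 + norm x ^ m" for x :: 'a
    by (simp add: add_pos_nonneg)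
  have le: "norm (T x * g x) \<le> C * (norm (T x) * inverse (1 + norm x ^ m))" for x
    using mult_left_mono[OF g(2)[of x], of "norm (T x)"] pos[of x]
    by (simp add: norm_mult field_simps)
  have [measurable]: "g \<in> borel_measurable lebesgue" "T \<in> borel_measurable lebesgue"
    using T(2) g(1) by (auto intro: measurable_completion)
  have 1: "integrable lebesgue (\<lambda>x. C * (norm (T x) * inverse (1 + norm x ^ m)))"
    using T(1) by simp
  show 2: "integrable lebesgue (\<lambda>x. T x * g x)"
    by (rule Bochner_Integration.integrable_bound[OF 1])
      (use le in \<open>auto intro!: AE_I2 order_trans[OF le]\<close>)
  show "norm (LINT x|lebesgue. T x * g x) \<le> C * (LINT x|lebesgue. norm (T x) * inverse (1 + norm x ^ m))"
    using Bochner_Integration.integral_norm_bound_integral[OF 2 1] le by simp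
qed

lemma integrable_slowly_increasing_mult:
  fixes T g :: "'a::euclidean_space \<Rightarrow> complex"
  assumes "slowly_increasing T" "rapidly_decreasing g" "g \<in> borel_measurable borel"
  shows "integrable lebesgue (\<lambda>x. T x * g x)"
proof -
  obtain m where "integrable lebesgue (\<lambda>x. norm (T x) * inverse (1 + norm x ^ m))" "T \<in> borel_measurable lebesgue"
    using slowly_increasing_weight[OF assms(1)] by blast
  moreover obtain C where "\<And>x. (1 + norm x ^ m) * norm (g x) \<le> C"
    using rapidly_decreasing_weight[OF assms(2)] by metis
  ultimately show ?thesis
    using slowly_increasing_mult_bound(1) assms(3) by blast
qed

section \<open>Closure properties of the Schwartz space\<close>

lemma iter_partial_Nil [simp]: "iter_partial [] \<phi> = \<phi>"
  by (simp add: iter_partial_def)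

lemma iter_partial_Cons:
  "iter_partial (b # bs) \<phi> = (\<lambda>x. frechet_derivative (iter_partial bs \<phi>) (at x) b)"
  by (simp add: iter_partial_def)

text \<open>\<open>foldr\<close> differentiates along the last list entry first, so a derivative
  taken before all others is appended at the end, whereas \<open>iter_partial_Cons\<close> adds the
  outermost one.\<close>

lemma iter_partial_partial:
  "iter_partial bs (\<lambda>x. frechet_derivative \<phi> (at x) b) = iter_partial (bs @ [b]) \<phi>"
  by (simp add: iter_partial_def)

lemma schwartz_differentiable: "\<phi> \<in> schwartz \<Longrightarrow> \<phi> differentiable at x"
  unfolding schwartz_def smooth_def by (auto dest!: spec[of _ "[]"])

lemma schwartz_rapidly_decreasing: "\<phi> \<in> schwartz \<Longrightarrow> rapidly_decreasing \<phi>"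
  unfolding schwartz_def rapidly_decreasing_iff_bounded by (force dest!: spec[of _ "[]"])

lemma schwartz_partial:
  assumes "\<phi> \<in> schwartz" "b \<in> Basis"
  shows "(\<lambda>x. frechet_derivative \<phi> (at x) b) \<in> schwartz"
  using assms unfolding schwartz_def smooth_def by (auto simp: iter_partial_partial)

lemma schwartz_continuous: "\<phi> \<in> schwartz \<Longrightarrow> continuous_on A \<phi>"
  by (intro continuous_at_imp_continuous_on ballI differentiable_imp_continuous_within schwartz_differentiable)

lemma schwartz_measurable: "\<phi> \<in> schwartz \<Longrightarrow> \<phi> \<in> borel_measurable borel"
  by (intro borel_measurable_continuous_onI schwartz_continuous)

lemma schwartz_integrable: "\<phi> \<in> schwartz \<Longrightarrow> integrable lborel \<phi>"
  by (intro integrable_rapidly_decreasing schwartz_rapidly_decreasing schwartz_measurable)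

text \<open>\<open>schwartz\<close> is the largest set of differentiable, rapidly decreasing
  functions that is stable under partial derivatives, since every iterated partial stays in such a
  set. Membership proofs thus need one derivative at a time and no Leibniz formula.\<close>

lemma schwartz_coinduct:
  assumes "\<phi> \<in> X"
    and diff: "\<And>g x. g \<in> X \<Longrightarrow> g differentiable at x"
    and decay: "\<And>g. g \<in> X \<Longrightarrow> rapidly_decreasing g"
    and part: "\<And>g b. g \<in> X \<Longrightarrow> b \<in> Basis \<Longrightarrow> (\<lambda>x. frechet_derivative g (at x) b) \<in> X"
  shows "\<phi> \<in> schwartz"
proof -
  have "iter_partial bs \<phi> \<in> X" if "set bs \<subseteq> Basis" for bs
    using that by (induction bs) (auto simp: assms(1) iter_partial_Cons part)
  then show ?thesis
    unfolding schwartz_def smooth_def using diff decay by (auto simp: rapidly_decreasing_iff_bounded)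
qed

text \<open>The module over the polynomials generated by \<open>S\<close>. Differentiating a
  coordinate times a generator leaves \<open>S\<close> but not this span.\<close>

inductive_set coord_span :: "('a::euclidean_space \<Rightarrow> complex) set \<Rightarrow> ('a \<Rightarrow> complex) set" for S where
  base: "g \<in> S \<Longrightarrow> g \<in> coord_span S"
| coord: "g \<in> coord_span S \<Longrightarrow> b \<in> Basis \<Longrightarrow> (\<lambda>x. of_real (x \<bullet> b) * g x) \<in> coord_span S"
| add: "g \<in> coord_span S \<Longrightarrow> h \<in> coord_span S \<Longrightarrow> (\<lambda>x. g x + h x) \<in> coord_span S"
| cmult: "g \<in> coord_span S \<Longrightarrow> (\<lambda>x. c * g x) \<in> coord_span S"

text \<open>By linearity and the product rule the span inherits differentiability, decay and
  stability under partials from its generators, so it is a valid invariant for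
  \<open>schwartz_coinduct\<close>.\<close>

lemma coord_span_subset_schwartz:
  assumes diff: "\<And>g x. g \<in> S \<Longrightarrow> g differentiable at x"
    and decay: "\<And>g. g \<in> S \<Longrightarrow> rapidly_decreasing g"
    and part: "\<And>g b. g \<in> S \<Longrightarrow> b \<in> Basis \<Longrightarrow> (\<lambda>x. frechet_derivative g (at x) b) \<in> coord_span S"
  shows "coord_span S \<subseteq> schwartz"
proof
  fix \<phi> assume "\<phi> \<in> coord_span S"
  have main: "(\<forall>x. g differentiable at x) \<and> rapidly_decreasing g \<and>
      (\<forall>b\<in>Basis. (\<lambda>x. frechet_derivative g (at x) b) \<in> coord_span S)" if "g \<in> coord_span S" for g
    using that
  proof induction
    case (base g)
    then show ?case
      using assms by blast
  next
    case (coord g b)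
    then have g: "(g has_derivative frechet_derivative g (at x)) (at x)" for x
      by (simp add: frechet_derivative_works)
    have d: "((\<lambda>x. of_real (x \<bullet> b) * g x) has_derivative
        (\<lambda>h. of_real (x \<bullet> b) * frechet_derivative g (at x) h + of_real (h \<bullet> b) * g x)) (at x)" for x
      by (rule derivative_eq_intros g refl)+ (simp add: ac_simps)
    have f: "frechet_derivative (\<lambda>x. of_real (x \<bullet> b) * g x) (at x) =
        (\<lambda>h. of_real (x \<bullet> b) * frechet_derivative g (at x) h + of_real (h \<bullet> b) * g x)" for x
      using frechet_derivative_at[OF d] by metis
    have "rapidly_decreasing (\<lambda>x. norm x ^ 1 *\<^sub>R g x)"
      using coord.IH by (intro rapidly_decreasing_power) auto
    then have "rapidly_decreasing (\<lambda>x. of_real (x \<bullet> b) * g x)"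
      by (rule rapidly_decreasing_bound[where c = 1])
        (auto simp: norm_mult Basis_le_norm coord.hyps intro!: mult_right_mono)
    moreover have "(\<lambda>x. frechet_derivative (\<lambda>x. of_real (x \<bullet> b) * g x) (at x) c) \<in> coord_span S"
      if "c \<in> Basis" for c
      unfolding f using coord that by (intro coord_span.add coord_span.coord coord_span.cmult) auto
    ultimately show ?case
      using d by (auto intro: differentiableI)
  next
    case (add g h)
    then have g: "(g has_derivative frechet_derivative g (at x)) (at x)"
      and h: "(h has_derivative frechet_derivative h (at x)) (at x)" for x
      by (simp_all add: frechet_derivative_works)
    have d: "((\<lambda>x. g x + h x) has_derivative
        (\<lambda>v. frechet_derivative g (at x) v + frechet_derivative h (at x) v)) (at x)" for x
      by (rule has_derivative_add g h)+
    have f: "frechet_derivative (\<lambda>x. g x + h x) (at x) =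
        (\<lambda>v. frechet_derivative g (at x) v + frechet_derivative h (at x) v)" for x
      using frechet_derivative_at[OF d] by metis
    show ?case
      unfolding f using d add.IH by (auto intro: differentiableI rapidly_decreasing_add coord_span.add)
  next
    case (cmult g c)
    then have g: "(g has_derivative frechet_derivative g (at x)) (at x)" for x
      by (simp_all add: frechet_derivative_works)
    have d: "((\<lambda>x. c * g x) has_derivative (\<lambda>v. c * frechet_derivative g (at x) v)) (at x)" for x
      by (rule has_derivative_mult_right g)+
    have f: "frechet_derivative (\<lambda>x. c * g x) (at x) = (\<lambda>v. c * frechet_derivative g (at x) v)" for x
      using frechet_derivative_at[OF d] by metis
    have "rapidly_decreasing (\<lambda>x. c * g x)"
      using cmult.IH by (auto intro: rapidly_decreasing_bound[where g = g and c = "norm c"] simp: norm_mult)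
    then show ?case
      unfolding f using d cmult.IH by (auto intro: differentiableI coord_span.cmult)
  qed
  show "\<phi> \<in> schwartz"
    by (rule schwartz_coinduct[OF \<open>\<phi> \<in> coord_span S\<close>]) (use main in auto)
qed

lemma schwartz_coord_span: "coord_span schwartz \<subseteq> schwartz"
  by (rule coord_span_subset_schwartz)
    (auto intro: schwartz_differentiable schwartz_rapidly_decreasing coord_span.base schwartz_partial)

lemma schwartz_coord: "\<phi> \<in> schwartz \<Longrightarrow> b \<in> Basis \<Longrightarrow> (\<lambda>x. of_real (x \<bullet> b) * \<phi> x) \<in> schwartz"
  using schwartz_coord_span coord_span.coord[OF coord_span.base] by blast

lemma schwartz_add: "\<phi> \<in> schwartz \<Longrightarrow> \<psi> \<in> schwartz \<Longrightarrow> (\<lambda>x. \<phi> x + \<psi> x) \<in> schwartz"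
  using schwartz_coord_span coord_span.add[OF coord_span.base coord_span.base] by blast

lemma schwartz_cmult: "\<phi> \<in> schwartz \<Longrightarrow> (\<lambda>x. c * \<phi> x) \<in> schwartz"
  using schwartz_coord_span coord_span.cmult[OF coord_span.base] by blast

text \<open>A single term of the exponential series, \<open>y ^ k / fact k \<le> exp y\<close> with
  \<open>y = a * (norm x)\<^sup>2\<close>, bounds the even power 2k; the power k is then at most 1
  plus the power 2k.\<close>

lemma rapidly_decreasing_gaussian:
  fixes a :: real
  assumes "a > 0"
  shows "rapidly_decreasing (\<lambda>x::'a::real_normed_vector. exp (- (a * (norm x)\<^sup>2)))"
  unfolding rapidly_decreasing_def
proof
  fix k
  have "norm x ^ k * norm (exp (- (a * (norm x)\<^sup>2))) \<le> 1 + fact k / a ^ k" for x :: 'a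
  proof -
    define y where "y = a * (norm x)\<^sup>2"
    have "0 \<le> y"
      using assms by (simp add: y_def)
    have "y ^ k / fact k \<le> exp y"
      unfolding exp_def using summable_exp[of y] sum_le_suminf[of "\<lambda>n. y ^ n /\<^sub>R fact n" "{k}"] \<open>0 \<le> y\<close>
      by (simp add: divide_inverse mult.commute)
    then have "a ^ k * (norm x ^ (2 * k)) \<le> exp y * fact k"
      unfolding power_mult by (simp add: y_def power_mult_distrib field_simps)
    then have 1: "norm x ^ (2 * k) * exp (- y) \<le> fact k / a ^ k"
      using assms by (simp add: field_simps exp_minus)
    have "norm x ^ k \<le> 1 + norm x ^ (2 * k)"
      using sum_squares_bound[of 1 "norm x ^ k"] zero_le_power[of "norm x" k]
      by (simp add: power_mult[symmetric] mult.commute) (smt (verit) zero_le_power norm_ge_zero)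
    then have "norm x ^ k * exp (- y) \<le> (1 + norm x ^ (2 * k)) * exp (- y)"
      by (intro mult_right_mono) auto
    also have "\<dots> \<le> 1 + fact k / a ^ k"
      using 1 \<open>0 \<le> y\<close> by (simp add: algebra_simps add_mono)
    finally show ?thesis
      by (simp add: y_def)
  qed
  then show "\<exists>C. \<forall>x::'a. norm x ^ k * norm (exp (- (a * (norm x)\<^sup>2))) \<le> C"
    by blast
qed

text \<open>The factor \<open>pi\<close> matches the \<open>2 * pi\<close> in the Fourier kernel:
  the transform replaces \<open>a\<close> by \<open>1 / a\<close>, and \<open>gaussian 1\<close> is
  its own transform with integral 1.\<close>

definition gaussian :: "real \<Rightarrow> 'a::euclidean_space \<Rightarrow> complex" where
  "gaussian a x = of_real (exp (- (pi * a * (norm x)\<^sup>2)))"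

lemma gaussian_coord_span:
  assumes "a > 0"
  shows "coord_span {gaussian a :: 'a::euclidean_space \<Rightarrow> complex} \<subseteq> schwartz"
proof (rule coord_span_subset_schwartz)
  have d: "(gaussian a has_derivative (\<lambda>h. of_real (-2 * pi * a * (x \<bullet> h)) * gaussian a x)) (at x)" for x :: 'a
    unfolding gaussian_def power2_norm_eq_inner
    by (rule derivative_eq_intros refl)+ (simp add: algebra_simps inner_commute)
  have f: "frechet_derivative (gaussian a) (at x) = (\<lambda>h. of_real (-2 * pi * a * (x \<bullet> h)) * gaussian a x)" for x :: 'a
    using frechet_derivative_at[OF d] by metis
  fix g :: "'a \<Rightarrow> complex"
  assume "g \<in> {gaussian a}"
  then have g: "g = gaussian a" by simp
  show "g differentiable at x" for x
    using d g by (auto intro: differentiableI)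
  show "rapidly_decreasing g"
    using rapidly_decreasing_gaussian[of "pi * a", where 'a = 'a] assms
    by (rule_tac rapidly_decreasing_bound[where c = 1]) (auto simp: g gaussian_def)
  fix b :: 'a
  assume "b \<in> Basis"
  have "(\<lambda>x. frechet_derivative g (at x) b) = (\<lambda>x. of_real (-2 * pi * a) * (of_real (x \<bullet> b) * gaussian a x))"
    unfolding g f by (simp add: mult.assoc)
  then show "(\<lambda>x. frechet_derivative g (at x) b) \<in> coord_span {gaussian a}"
    using \<open>b \<in> Basis\<close> by (simp only:) (intro coord_span.cmult coord_span.coord coord_span.base singletonI)
qed

lemma gaussian_schwartz: "a > 0 \<Longrightarrow> gaussian a \<in> schwartz"
  using gaussian_coord_span coord_span.base by blast

section \<open>The Fourier transform on the Schwartz space\<close>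

lemma lborel_integral_affine:
  fixes f :: "'a::euclidean_space \<Rightarrow> complex"
  assumes [measurable]: "f \<in> borel_measurable borel" and "c \<noteq> 0"
  shows "(LINT x|lborel. f x) = \<bar>c\<bar> ^ DIM('a) *\<^sub>R (LINT x|lborel. f (t + c *\<^sub>R x))"
  by (subst lborel_affine[OF assms(2), of t], subst integral_density)
    (auto simp: integral_distr)

lemma lborel_integral_translation:
  fixes f :: "'a::euclidean_space \<Rightarrow> complex"
  assumes "f \<in> borel_measurable borel"
  shows "(LINT x|lborel. f (x + t)) = (LINT x|lborel. f x)"
  using lborel_integral_affine[OF assms, of 1 t] by (simp add: add.commute)

lemma lborel_integrable_translation:
  fixes f :: "'a::euclidean_space \<Rightarrow> complex"
  assumes "integrable lborel f"
  shows "integrable lborel (\<lambda>x. f (x + t))"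
  using assms integrable_distr[of "(+) t" lborel borel f]
  by (simp add: lborel_distr_plus add.commute)

text \<open>The Fourier character of frequency \<open>v\<close>, phrased with \<open>iexp\<close> to
  match the Taylor estimates and characteristic functions used below.\<close>

definition wave :: "'a::euclidean_space \<Rightarrow> 'a \<Rightarrow> complex" where
  "wave v x = iexp (- 2 * pi * (x \<bullet> v))"

lemma fourier_wave: "fourier \<phi> v = (LINT x|lborel. wave v x * \<phi> x)"
  unfolding fourier_def wave_def
  by (rule Bochner_Integration.integral_cong) (simp_all add: mult_ac)

lemma norm_wave [simp]: "norm (wave v x) = 1"
  by (simp add: wave_def)

lemma wave_add: "wave v (x + y) = wave v x * wave v y"
  by (simp add: wave_def inner_add_left algebra_simps flip: exp_add)

lemma wave_commute: "wave v x = wave x v"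
  by (simp add: wave_def inner_commute)

lemma wave_continuous [continuous_intros]:
  fixes f :: "'b::topological_space \<Rightarrow> 'a::euclidean_space"
  shows "continuous_on A f \<Longrightarrow> continuous_on A g \<Longrightarrow> continuous_on A (\<lambda>x. wave (f x) (g x))"
  unfolding wave_def by (intro continuous_intros)

lemma wave_measurable [measurable]: "wave v \<in> borel_measurable borel"
  by (intro borel_measurable_continuous_onI continuous_intros)

lemma wave_has_derivative:
  "(wave v has_derivative (\<lambda>h. of_real (h \<bullet> v) * (- 2 * pi * \<i> * wave v x))) (at x)"
proof -
  have "((\<lambda>x. \<i> * complex_of_real (- 2 * pi * (x \<bullet> v))) has_derivative
      (\<lambda>h. \<i> * complex_of_real (- 2 * pi * (h \<bullet> v)))) (at x)"
    by (rule derivative_eq_intros refl)+ (simp add: algebra_simps)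
  from has_derivative_compose[OF this DERIV_exp[unfolded has_field_derivative_def]] show ?thesis
    unfolding wave_def by (rule has_derivative_eq_rhs) (simp add: fun_eq_iff mult_ac)
qed

lemma integrable_wave_mult:
  "integrable lborel \<phi> \<Longrightarrow> integrable lborel (\<lambda>x. wave v x * \<phi> x)"
  by (rule Bochner_Integration.integrable_bound[where f = \<phi>]) (auto simp: norm_mult)

lemma fourier_add:
  "integrable lborel \<phi> \<Longrightarrow> integrable lborel \<psi> \<Longrightarrow> fourier (\<lambda>x. \<phi> x + \<psi> x) = (\<lambda>v. fourier \<phi> v + fourier \<psi> v)"
  by (simp add: fourier_wave fun_eq_iff distrib_left integrable_wave_mult)

lemma fourier_cmult: "fourier (\<lambda>x. c * \<phi> x) = (\<lambda>v. c * fourier \<phi> v)"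
  by (simp add: fourier_wave fun_eq_iff mult.left_commute[of _ c])

lemma norm_fourier_le: "norm (fourier \<phi> v) \<le> (LINT x|lborel. norm (\<phi> x))"
  unfolding fourier_wave using integral_norm_bound[of lborel "\<lambda>x. wave v x * \<phi> x"] by (simp add: norm_mult)

text \<open>By translation invariance every difference quotient has integral zero; pass to the limit by dominated convergence.\<close>

lemma integral_directional_derivative_zero:
  fixes g :: "'a::euclidean_space \<Rightarrow> complex"
  assumes deriv: "\<And>x. (g has_derivative D x) (at x)"
    and int: "integrable lborel g"
    and decay: "rapidly_decreasing (\<lambda>x. D x b)"
    and meas[measurable]: "(\<lambda>x. D x b) \<in> borel_measurable borel"
    and b: "norm b \<le> 1"
  shows "(LINT x|lborel. D x b) = 0"
proof -
  let ?m = "2 * DIM('a)"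
  obtain C where C: "\<And>x. (1 + norm x ^ ?m) * norm (D x b) \<le> C"
    using rapidly_decreasing_weight[OF decay] by metis
  define K where "K = 2 ^ Suc ?m * C"
  have lin: "linear (D x)" for x
    using deriv by (rule has_derivative_linear)
  have pos: "0 < 1 + norm x ^ ?m" for x :: 'a
    by (simp add: add_pos_nonneg)
  \<comment> \<open>Moving the point by at most 1 changes the weight by at most the factor
    \<open>2 ^ Suc ?m\<close> in \<open>K\<close>, so one integrable function of \<open>x\<close>
    dominates the derivative along the whole segment from \<open>x\<close> to
    \<open>x + b\<close>.\<close>
  have bound: "norm (D (x + s *\<^sub>R b) b) \<le> K * inverse (1 + norm x ^ ?m)" if "0 \<le> s" "s \<le> 1" for x s
  proof -
    let ?y = "x + s *\<^sub>R b"
    have "norm x \<le> norm ?y + norm (s *\<^sub>R b)"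
      using norm_triangle_ineq4[of ?y "s *\<^sub>R b"] by simp
    also have "norm (s *\<^sub>R b) \<le> 1"
      using that b mult_mono[of "\<bar>s\<bar>" 1 "norm b" 1] by simp
    finally have "norm x ^ ?m \<le> (1 + norm ?y) ^ ?m"
      by (intro power_mono) auto
    also have "\<dots> \<le> 2 ^ ?m * (1 + norm ?y ^ ?m)"
      by (rule one_plus_power_le) simp
    finally have "norm x ^ ?m \<le> 2 ^ ?m * (1 + norm ?y ^ ?m)" .
    moreover have "1 \<le> (2::real) ^ ?m * (1 + norm ?y ^ ?m)"
      using mult_mono[of 1 "(2::real) ^ ?m" 1 "1 + norm ?y ^ ?m"] by simp
    ultimately have "1 + norm x ^ ?m \<le> 2 ^ Suc ?m * (1 + norm ?y ^ ?m)"
      by simp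
    then have "(1 + norm x ^ ?m) * norm (D ?y b) \<le> 2 ^ Suc ?m * (1 + norm ?y ^ ?m) * norm (D ?y b)"
      by (intro mult_right_mono) auto
    also have "\<dots> \<le> K"
      unfolding K_def mult.assoc by (intro mult_left_mono C) auto
    finally show ?thesis
      using pos[of x] by (simp add: field_simps)
  qed
  let ?t = "\<lambda>n. inverse (real (Suc n))"
  let ?q = "\<lambda>n x. (g (x + ?t n *\<^sub>R b) - g x) /\<^sub>R ?t n"
  have gm[measurable]: "g \<in> borel_measurable borel"
    using int by simp
  have int0: "integral\<^sup>L lborel (?q n) = 0" for n
    using lborel_integral_translation[OF gm, of "?t n *\<^sub>R b"]
      lborel_integrable_translation[OF int, of "?t n *\<^sub>R b"] int by simp
  have "(\<lambda>n. integral\<^sup>L lborel (?q n)) \<longlonglongrightarrow> (LINT x|lborel. D x b)"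
  proof (rule integral_dominated_convergence)
    show "integrable lborel (\<lambda>x::'a. K * inverse (1 + norm x ^ ?m))"
      using integrable_inverse_weight[where 'a='a] by simp
    show "AE x in lborel. (\<lambda>n. ?q n x) \<longlonglongrightarrow> D x b"
    proof (rule AE_I2)
      fix x
      have "((\<lambda>s. g (x + s *\<^sub>R b)) has_derivative (\<lambda>s. D (x + 0 *\<^sub>R b) (s *\<^sub>R b))) (at 0)"
        by (rule has_derivative_compose[where f = "\<lambda>s. x + s *\<^sub>R b" and g = g]) (auto intro!: derivative_eq_intros deriv)
      then have "((\<lambda>s. g (x + s *\<^sub>R b)) has_vector_derivative D x b) (at 0)"
        by (simp add: has_vector_derivative_def linear_scale[OF lin])
      then have lim: "((\<lambda>s. norm (g (x + s *\<^sub>R b) - g x - s *\<^sub>R D x b) / \<bar>s\<bar>) \<longlongrightarrow> 0) (at 0)"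
        by (simp add: has_vector_derivative_def has_derivative_at)
      have quot: "norm (g (x + s *\<^sub>R b) - g x - s *\<^sub>R D x b) / \<bar>s\<bar> =
          norm ((g (x + s *\<^sub>R b) - g x) /\<^sub>R s - D x b)" if "s \<noteq> 0" for s
      proof -
        have "(g (x + s *\<^sub>R b) - g x) /\<^sub>R s - D x b = (g (x + s *\<^sub>R b) - g x - s *\<^sub>R D x b) /\<^sub>R s"
          using that by (simp add: scaleR_diff_right)
        then show ?thesis
          by (simp add: divide_inverse mult.commute)
      qed
      have "\<forall>\<^sub>F s in at 0. norm (g (x + s *\<^sub>R b) - g x - s *\<^sub>R D x b) / \<bar>s\<bar> =
          norm ((g (x + s *\<^sub>R b) - g x) /\<^sub>R s - D x b)"
        using quot by (simp add: eventually_at_filter)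
      with lim have "((\<lambda>s. norm ((g (x + s *\<^sub>R b) - g x) /\<^sub>R s - D x b)) \<longlongrightarrow> 0) (at 0)"
        by (rule Lim_transform_eventually)
      then have "((\<lambda>s. (g (x + s *\<^sub>R b) - g x) /\<^sub>R s) \<longlongrightarrow> D x b) (at 0)"
        by (simp add: tendsto_norm_zero_iff LIM_zero_iff)
      moreover have "filterlim ?t (at 0) sequentially"
        using LIMSEQ_inverse_real_of_nat by (auto simp: filterlim_at)
      ultimately show "(\<lambda>n. ?q n x) \<longlonglongrightarrow> D x b"
        by (rule filterlim_compose)
    qed
    show "AE x in lborel. norm (?q n x) \<le> K * inverse (1 + norm x ^ ?m)" for n
    proof (rule AE_I2)
      fix x
      let ?c = "\<lambda>s. g (x + s *\<^sub>R b)"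
      have d: "(?c has_derivative (\<lambda>h. D (x + s *\<^sub>R b) (h *\<^sub>R b))) (at s)" for s
        by (rule has_derivative_compose[where f = "\<lambda>s. x + s *\<^sub>R b" and g = g]) (auto intro!: derivative_eq_intros deriv)
      define t where "t = ?t n"
      have t: "0 < t" "t \<le> 1"
        by (auto simp: t_def field_simps)
      have "continuous_on {0..t} ?c"
        using d has_derivative_continuous by (intro continuous_at_imp_continuous_on) blast
      \<comment> \<open>The mean value inequality bounds the difference quotient by the derivative
        at an intermediate point of the segment, where \<open>bound\<close> applies.\<close>
      then obtain s where s: "0 < s" "s < t"
          "norm (?c t - ?c 0) \<le> norm (D (x + s *\<^sub>R b) ((t - 0) *\<^sub>R b))"
        using mvt_general[of 0 t ?c, OF _ _ d] t by (auto simp del: diff_zero)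
      have "norm (D (x + s *\<^sub>R b) b) \<le> K * inverse (1 + norm x ^ ?m)"
        using s t by (intro bound) auto
      moreover have "norm (?q n x) \<le> norm (D (x + s *\<^sub>R b) b)"
      proof -
        have "norm (?q n x) = inverse t * norm (g (x + t *\<^sub>R b) - g x)"
          unfolding t_def[symmetric] norm_scaleR using t by simp
        also have "\<dots> \<le> inverse t * (t * norm (D (x + s *\<^sub>R b) b))"
          using s(3) t by (intro mult_left_mono) (auto simp: linear_scale[OF lin])
        also have "\<dots> = norm (D (x + s *\<^sub>R b) b)"
          using t by (simp add: mult.assoc[symmetric])
        finally show ?thesis .
      qed
      ultimately show "norm (?q n x) \<le> K * inverse (1 + norm x ^ ?m)"
        by linarith
    qed
  qed measurable
  then show ?thesis
    unfolding int0 LIMSEQ_const_iff by (rule sym)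
qed

text \<open>Integration by parts: the derivative of \<open>wave v x * \<phi> x\<close> along
  \<open>b\<close> integrates to zero, and the term in which the wave is differentiated carries the
  factor \<open>- 2 * pi * \<i> * (v \<bullet> b)\<close>.\<close>

lemma fourier_partial:
  assumes "\<phi> \<in> schwartz" "b \<in> Basis"
  shows "fourier (\<lambda>x. frechet_derivative \<phi> (at x) b) v = 2 * pi * \<i> * of_real (v \<bullet> b) * fourier \<phi> v"
proof -
  let ?d = "\<lambda>x. frechet_derivative \<phi> (at x) b"
  let ?D = "\<lambda>x h. wave v x * frechet_derivative \<phi> (at x) h + of_real (h \<bullet> v) * (- 2 * pi * \<i> * wave v x) * \<phi> x"
  have s: "?d \<in> schwartz"
    using assms by (rule schwartz_partial)
  have d: "((\<lambda>x. wave v x * \<phi> x) has_derivative ?D x) (at x)" for x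
    using schwartz_differentiable[OF assms(1), of x, unfolded frechet_derivative_works]
    by (intro has_derivative_eq_rhs[OF has_derivative_mult[OF wave_has_derivative]]) auto
  have i: "integrable lborel (\<lambda>x. wave v x * ?d x)" "integrable lborel (\<lambda>x. wave v x * \<phi> x)"
    using s assms(1) by (auto intro: integrable_wave_mult schwartz_integrable)
  have "(LINT x|lborel. ?D x b) = 0"
  proof (rule integral_directional_derivative_zero[OF d i(2)])
    have "rapidly_decreasing (\<lambda>x. wave v x * ?d x)"
      by (rule rapidly_decreasing_bound[OF schwartz_rapidly_decreasing[OF s], where c = 1]) (auto simp: norm_mult)
    moreover have "rapidly_decreasing (\<lambda>x. of_real (b \<bullet> v) * (- 2 * pi * \<i> * wave v x) * \<phi> x)"
      by (rule rapidly_decreasing_bound[OF schwartz_rapidly_decreasing[OF assms(1)], where c = "\<bar>b \<bullet> v\<bar> * (2 * pi)"])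
        (auto simp: norm_mult)
    ultimately show "rapidly_decreasing (\<lambda>x. ?D x b)"
      by (rule rapidly_decreasing_add)
    have [measurable]: "?d \<in> borel_measurable borel" "\<phi> \<in> borel_measurable borel"
      using s assms(1) by (auto intro: schwartz_measurable)
    show "(\<lambda>x. ?D x b) \<in> borel_measurable borel"
      by measurable
  qed (use assms in simp)
  also have "(LINT x|lborel. ?D x b) =
      (LINT x|lborel. wave v x * ?d x + (- 2 * pi * \<i> * of_real (v \<bullet> b)) * (wave v x * \<phi> x))"
    by (simp add: mult_ac inner_commute)
  also have "\<dots> = fourier ?d v - 2 * pi * \<i> * of_real (v \<bullet> b) * fourier \<phi> v"
    using i unfolding fourier_wave by (subst Bochner_Integration.integral_add) auto
  finally show ?thesis
    by simp
qed

text \<open>Differentiation under the integral with an explicit remainder: the first-order Taylor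
  error of \<open>iexp\<close> is at most half the square of its argument, which integrates to
  \<open>K * (norm h)\<^sup>2\<close>, where \<open>K\<close> is a second moment of \<phi>.\<close>

lemma fourier_has_derivative:
  assumes "\<phi> \<in> schwartz"
  shows "(fourier \<phi> has_derivative
    (\<lambda>h. \<Sum>b\<in>Basis. (h \<bullet> b) *\<^sub>R fourier (\<lambda>x. - 2 * pi * \<i> * (of_real (x \<bullet> b) * \<phi> x)) v)) (at v)"
    (is "(_ has_derivative ?L) _")
proof -
  have s: "(\<lambda>x. - 2 * pi * \<i> * (of_real (x \<bullet> b) * \<phi> x)) \<in> schwartz" if "b \<in> Basis" for b
    using assms that by (intro schwartz_cmult schwartz_coord)
  define K where "K = (LINT x|lborel. (2 * pi)\<^sup>2 / 2 * ((norm x)\<^sup>2 * norm (\<phi> x)))"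
  have iK: "integrable lborel (\<lambda>x. (2 * pi)\<^sup>2 / 2 * ((norm x)\<^sup>2 * norm (\<phi> x)))"
    using integrable_norm[OF integrable_rapidly_decreasing[OF
        rapidly_decreasing_power[OF schwartz_rapidly_decreasing[OF assms], of 2]]]
      schwartz_measurable[OF assms] by simp
  have "0 \<le> K"
    unfolding K_def by (intro integral_nonneg_AE) auto
  have L: "?L h = (LINT x|lborel. wave v x * (- 2 * pi * \<i> * (of_real (x \<bullet> h) * \<phi> x)))"
    and iL: "integrable lborel (\<lambda>x. wave v x * (- 2 * pi * \<i> * (of_real (x \<bullet> h) * \<phi> x)))" for h
  proof -
    have eq: "wave v x * (- 2 * pi * \<i> * (of_real (x \<bullet> h) * \<phi> x)) =
        (\<Sum>b\<in>Basis. (h \<bullet> b) *\<^sub>R (wave v x * (- 2 * pi * \<i> * (of_real (x \<bullet> b) * \<phi> x))))" for x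
      unfolding euclidean_inner[of x h]
      by (simp add: sum_distrib_left sum_distrib_right scaleR_conv_of_real mult_ac)
    have i: "integrable lborel (\<lambda>x. (h \<bullet> b) *\<^sub>R (wave v x * (- 2 * pi * \<i> * (of_real (x \<bullet> b) * \<phi> x))))"
      if "b \<in> Basis" for b
      by (intro integrable_scaleR_right integrable_wave_mult schwartz_integrable s that)
    show "integrable lborel (\<lambda>x. wave v x * (- 2 * pi * \<i> * (of_real (x \<bullet> h) * \<phi> x)))"
      unfolding eq using i by (rule Bochner_Integration.integrable_sum)
    show "?L h = (LINT x|lborel. wave v x * (- 2 * pi * \<i> * (of_real (x \<bullet> h) * \<phi> x)))"
      unfolding eq fourier_wave
      by (subst Bochner_Integration.integral_sum) (use i in auto)
  qed
  have rem: "norm (fourier \<phi> (v + h) - fourier \<phi> v - ?L h) \<le> K * (norm h)\<^sup>2" for h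
  proof -
    have i: "integrable lborel (\<lambda>x. wave (v + h) x * \<phi> x)" "integrable lborel (\<lambda>x. wave v x * \<phi> x)"
      using assms by (auto intro: integrable_wave_mult schwartz_integrable)
    have "fourier \<phi> (v + h) - fourier \<phi> v - ?L h =
        (LINT x|lborel. wave (v + h) x * \<phi> x - wave v x * \<phi> x - wave v x * (- 2 * pi * \<i> * (of_real (x \<bullet> h) * \<phi> x)))"
      unfolding L
      unfolding fourier_wave
      by (simp only: Bochner_Integration.integral_diff[OF Bochner_Integration.integrable_diff[OF i] iL]
          Bochner_Integration.integral_diff[OF i])
    also have "norm \<dots> \<le> (LINT x|lborel. (norm h)\<^sup>2 * ((2 * pi)\<^sup>2 / 2 * ((norm x)\<^sup>2 * norm (\<phi> x))))"
    proof (rule Bochner_Integration.integral_norm_bound_integral)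
      show "integrable lborel (\<lambda>x. wave (v + h) x * \<phi> x - wave v x * \<phi> x - wave v x * (- 2 * pi * \<i> * (of_real (x \<bullet> h) * \<phi> x)))"
        using i iL[of h] by (intro Bochner_Integration.integrable_diff)
      show "integrable lborel (\<lambda>x. (norm h)\<^sup>2 * ((2 * pi)\<^sup>2 / 2 * ((norm x)\<^sup>2 * norm (\<phi> x))))"
        using iK by (rule integrable_mult_right)
      fix x
      let ?y = "- 2 * pi * (x \<bullet> h)"
      have "wave (v + h) x * \<phi> x - wave v x * \<phi> x - wave v x * (- 2 * pi * \<i> * (of_real (x \<bullet> h) * \<phi> x))
          = wave v x * (iexp ?y - (\<Sum>k\<le>1. (\<i> * ?y) ^ k / fact k)) * \<phi> x"
        by (simp add: wave_commute[of _ x] wave_add) (simp add: wave_def algebra_simps inner_commute)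
      also have "norm \<dots> \<le> \<bar>?y\<bar>\<^sup>2 / 2 * norm (\<phi> x)"
        using mult_right_mono[OF iexp_approx1[of ?y 1], of "norm (\<phi> x)"]
        by (simp add: norm_mult numeral_2_eq_2)
      also have "\<bar>?y\<bar>\<^sup>2 \<le> (2 * pi * (norm x * norm h))\<^sup>2"
        using Cauchy_Schwarz_ineq2[of x h]
        by (intro power_mono) (auto simp: abs_mult)
      finally show "norm (wave (v + h) x * \<phi> x - wave v x * \<phi> x - wave v x * (- 2 * pi * \<i> * (of_real (x \<bullet> h) * \<phi> x)))
          \<le> (norm h)\<^sup>2 * ((2 * pi)\<^sup>2 / 2 * ((norm x)\<^sup>2 * norm (\<phi> x)))"
        by (simp add: power_mult_distrib mult_right_mono divide_right_mono mult_ac)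
    qed
    finally show ?thesis
      by (simp add: K_def mult.commute)
  qed
  show ?thesis
    unfolding has_derivative_at_alt
  proof (intro conjI allI impI)
    show "bounded_linear ?L"
      by (intro bounded_linear_sum bounded_linear_compose[OF bounded_linear_scaleR_left bounded_linear_inner_left])
    fix e :: real assume "0 < e"
    show "\<exists>d>0. \<forall>y. norm (y - v) < d \<longrightarrow> norm (fourier \<phi> y - fourier \<phi> v - ?L (y - v)) \<le> e * norm (y - v)"
    proof (intro exI conjI allI impI)
      show "0 < e / (K + 1)"
        using \<open>0 < e\<close> \<open>0 \<le> K\<close> by simp
      fix y assume "norm (y - v) < e / (K + 1)"
      then have "norm (y - v) * (K + 1) \<le> e"
        using \<open>0 \<le> K\<close> by (simp add: field_simps)
      then have "K * norm (y - v) \<le> e"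
        by (simp add: algebra_simps) (smt (verit) norm_ge_zero)
      then have "K * norm (y - v) * norm (y - v) \<le> e * norm (y - v)"
        by (rule mult_right_mono) simp
      then show "norm (fourier \<phi> y - fourier \<phi> v - ?L (y - v)) \<le> e * norm (y - v)"
        using rem[of "y - v"] by (simp add: power2_eq_square mult.assoc)
    qed
  qed
qed

lemma fourier_frechet_derivative:
  assumes "\<phi> \<in> schwartz" "b \<in> Basis"
  shows "frechet_derivative (fourier \<phi>) (at v) b = fourier (\<lambda>x. - 2 * pi * \<i> * (of_real (x \<bullet> b) * \<phi> x)) v"
proof -
  have "frechet_derivative (fourier \<phi>) (at v) =
      (\<lambda>h. \<Sum>b\<in>Basis. (h \<bullet> b) *\<^sub>R fourier (\<lambda>x. - 2 * pi * \<i> * (of_real (x \<bullet> b) * \<phi> x)) v)"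
    using frechet_derivative_at[OF fourier_has_derivative[OF assms(1)]] by metis
  then show ?thesis
    using assms(2) by (simp add: inner_Basis if_distrib[of "\<lambda>c. c *\<^sub>R _"] cong: if_cong)
qed

text \<open>The constant that turns a weighted supremum bound into an L^1 bound. It depends on the
  space alone, hence the type token as argument.\<close>

definition weight_mass :: "'a::euclidean_space itself \<Rightarrow> real" where
  "weight_mass _ = (LINT x::'a|lborel. inverse (1 + norm x ^ (2 * DIM('a))))"

text \<open>Transforming a partial derivative multiplies by
  \<open>2 * pi * \<i> * (v \<bullet> b)\<close>, a gain of at least
  \<open>\<bar>v \<bullet> b\<bar>\<close>. Summing over the basis recovers \<open>norm v\<close>
  through the l^1 norm and costs a factor d per order. Linearity in \<open>e\<close> allows reuse
  for convergence in \<open>fourier_tendsto_weighted\<close>.\<close>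

lemma fourier_decay:
  fixes \<phi> :: "'a::euclidean_space \<Rightarrow> complex"
  assumes "\<phi> \<in> schwartz"
    and "\<And>bs x. set bs \<subseteq> Basis \<Longrightarrow> length bs \<le> k \<Longrightarrow>
      (1 + norm x ^ (2 * DIM('a))) * norm (iter_partial bs \<phi> x) \<le> e"
  shows "norm v ^ k * norm (fourier \<phi> v) \<le> DIM('a) ^ k * (weight_mass TYPE('a) * e)"
  using assms
proof (induction k arbitrary: \<phi>)
  case 0
  have pos: "0 < 1 + norm x ^ (2 * DIM('a))" for x :: 'a
    by (simp add: add_pos_nonneg)
  have "norm (fourier \<phi> v) \<le> (LINT x|lborel. norm (\<phi> x))"
    by (rule norm_fourier_le)
  also have "\<dots> \<le> (LINT x::'a|lborel. inverse (1 + norm x ^ (2 * DIM('a))) * e)"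
  proof (rule integral_mono)
    show "norm (\<phi> x) \<le> inverse (1 + norm x ^ (2 * DIM('a))) * e" for x
      using 0(2)[of "[]" x] pos[of x] by (simp add: field_simps)
  qed (use integrable_inverse_weight[where 'a='a] schwartz_integrable[OF 0(1)] in auto)
  finally show ?case
    by (simp add: weight_mass_def)
next
  case (Suc k)
  have step: "norm v ^ k * (\<bar>v \<bullet> b\<bar> * norm (fourier \<phi> v)) \<le> DIM('a) ^ k * (weight_mass TYPE('a) * e)"
    if "b \<in> Basis" for b
  proof -
    let ?d = "\<lambda>x. frechet_derivative \<phi> (at x) b"
    have "norm v ^ k * norm (fourier ?d v) \<le> DIM('a) ^ k * (weight_mass TYPE('a) * e)"
      using that Suc.prems by (intro Suc.IH schwartz_partial) (auto simp: iter_partial_partial)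
    moreover have "norm (fourier ?d v) = 2 * pi * (\<bar>v \<bullet> b\<bar> * norm (fourier \<phi> v))"
      unfolding fourier_partial[OF Suc.prems(1) that] by (simp add: norm_mult)
    moreover have "1 * (\<bar>v \<bullet> b\<bar> * norm (fourier \<phi> v)) \<le> 2 * pi * (\<bar>v \<bullet> b\<bar> * norm (fourier \<phi> v))"
      using pi_gt3 by (intro mult_right_mono) auto
    ultimately show ?thesis
      using mult_left_mono[of "\<bar>v \<bullet> b\<bar> * norm (fourier \<phi> v)" "norm (fourier ?d v)" "norm v ^ k"] by simp
  qed
  have "norm v ^ Suc k * norm (fourier \<phi> v) = norm v ^ k * (norm v * norm (fourier \<phi> v))"
    by simp
  also have "\<dots> \<le> norm v ^ k * ((\<Sum>b\<in>Basis. \<bar>v \<bullet> b\<bar>) * norm (fourier \<phi> v))"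
    by (intro mult_left_mono mult_right_mono norm_le_l1) auto
  also have "\<dots> = (\<Sum>b\<in>Basis. norm v ^ k * (\<bar>v \<bullet> b\<bar> * norm (fourier \<phi> v)))"
    by (simp add: sum_distrib_left sum_distrib_right)
  also have "\<dots> \<le> (\<Sum>b\<in>(Basis::'a set). DIM('a) ^ k * (weight_mass TYPE('a) * e))"
    by (rule sum_mono) (rule step)
  finally show ?case
    by simp
qed

lemma fourier_rapidly_decreasing:
  fixes \<phi> :: "'a::euclidean_space \<Rightarrow> complex"
  assumes "\<phi> \<in> schwartz"
  shows "rapidly_decreasing (fourier \<phi>)"
  unfolding rapidly_decreasing_def
proof
  fix k
  let ?B = "{bs. set bs \<subseteq> (Basis::'a set) \<and> length bs \<le> k}"
  have "\<exists>C. \<forall>x. (1 + norm x ^ (2 * DIM('a))) * norm (iter_partial bs \<phi> x) \<le> C" if "bs \<in> ?B" for bs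
  proof -
    have "rapidly_decreasing (iter_partial bs \<phi>)"
      using that assms unfolding schwartz_def rapidly_decreasing_iff_bounded by auto
    then show ?thesis
      by (metis rapidly_decreasing_weight)
  qed
  then obtain C where C: "\<And>bs x. bs \<in> ?B \<Longrightarrow> (1 + norm x ^ (2 * DIM('a))) * norm (iter_partial bs \<phi> x) \<le> C bs"
    by metis
  have "finite ?B"
    by (intro finite_lists_length_le) simp
  then have "C bs \<le> Max (C ` ?B)" if "bs \<in> ?B" for bs
    using that by simp
  then have "(1 + norm x ^ (2 * DIM('a))) * norm (iter_partial bs \<phi> x) \<le> Max (C ` ?B)"
    if "set bs \<subseteq> Basis" "length bs \<le> k" for bs x
    using C[of bs x] that order_trans by blast
  from fourier_decay[OF assms this]
  show "\<exists>C. \<forall>v. norm v ^ k * norm (fourier \<phi> v) \<le> C"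
    by blast
qed

text \<open>The image of \<open>schwartz\<close> under \<open>fourier\<close> is its own coinduction
  invariant: a partial derivative of a transform is the transform of \<phi> times a coordinate, up
  to a constant.\<close>

theorem fourier_schwartz:
  fixes \<phi> :: "'a::euclidean_space \<Rightarrow> complex"
  assumes "\<phi> \<in> schwartz"
  shows "fourier \<phi> \<in> schwartz"
proof (rule schwartz_coinduct[where X = "fourier ` schwartz"])
  fix g :: "'a \<Rightarrow> complex" assume "g \<in> fourier ` schwartz"
  then obtain \<psi> where \<psi>: "\<psi> \<in> schwartz" "g = fourier \<psi>"
    by blast
  show "g differentiable at x" for x
    using fourier_has_derivative[OF \<psi>(1)] \<psi>(2) by (auto intro: differentiableI)
  show "rapidly_decreasing g"
    using fourier_rapidly_decreasing \<psi> by simp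
  fix b :: 'a
  assume b: "b \<in> Basis"
  then have "(\<lambda>x. - 2 * pi * \<i> * (of_real (x \<bullet> b) * \<psi> x)) \<in> schwartz"
    using \<psi> by (intro schwartz_cmult schwartz_coord)
  then show "(\<lambda>x. frechet_derivative g (at x) b) \<in> fourier ` schwartz"
    unfolding \<psi>(2) fourier_frechet_derivative[OF \<psi>(1) b] by blast
qed (use assms in blast)

section \<open>Gaussians, Fourier inversion and tempered distributions\<close>

lemma gaussian_measurable [measurable]: "gaussian a \<in> borel_measurable borel"
  unfolding gaussian_def by measurable

text \<open>A rescaling of the characteristic function of the standard normal law: \<open>c\<close>
  turns \<open>exp (- (c * x)\<^sup>2 / 2)\<close> into \<open>exp (- (pi * a * x\<^sup>2))\<close>,
  and \<open>u\<close> is fixed by \<open>u * c = - 2 * pi * s\<close>.\<close>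

lemma gaussian_fourier_real:
  assumes "a > 0"
  shows "(LINT t|lborel. iexp (- 2 * pi * (t * s)) * gaussian a t) = gaussian (1 / a) s / of_real (sqrt a)"
proof -
  define c where "c = sqrt (2 * pi * a)"
  define u where "u = - 2 * pi * s / c"
  have c: "c > 0" "c\<^sup>2 = 2 * pi * a"
    using assms by (simp_all add: c_def)
  have "of_real (exp (- u\<^sup>2 / 2)) = (LINT x|lborel. std_normal_density x *\<^sub>R iexp (u * x))"
    using char_std_normal_distribution[THEN fun_cong, of u] unfolding char_def
    by (subst (asm) integral_density) auto
  also have "\<dots> = c *\<^sub>R (LINT x|lborel. std_normal_density (c * x) *\<^sub>R iexp (u * (c * x)))"
    using lborel_integral_real_affine[of c "\<lambda>x. std_normal_density x *\<^sub>R iexp (u * x)" 0] c by simp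
  also have "(\<lambda>x. std_normal_density (c * x) *\<^sub>R iexp (u * (c * x))) =
      (\<lambda>x. (1 / sqrt (2 * pi)) *\<^sub>R (iexp (- 2 * pi * (x * s)) * gaussian a x))"
  proof
    fix x :: real
    have 1: "u * (c * x) = - 2 * pi * (x * s)"
      using c by (simp add: u_def)
    have 2: "std_normal_density (c * x) = (1 / sqrt (2 * pi)) * exp (- (pi * a * x\<^sup>2))"
      using c by (simp add: std_normal_density_def power_mult_distrib)
    show "std_normal_density (c * x) *\<^sub>R iexp (u * (c * x)) =
        (1 / sqrt (2 * pi)) *\<^sub>R (iexp (- 2 * pi * (x * s)) * gaussian a x)"
      unfolding 1 2 by (simp add: gaussian_def scaleR_conv_of_real)
  qed
  also have "c *\<^sub>R (LINT x|lborel. (1 / sqrt (2 * pi)) *\<^sub>R (iexp (- 2 * pi * (x * s)) * gaussian a x)) =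
      sqrt a *\<^sub>R (LINT x|lborel. iexp (- 2 * pi * (x * s)) * gaussian a x)"
    by (simp add: c_def real_sqrt_mult)
  also have "u\<^sup>2 / 2 = pi * (1 / a) * (norm s)\<^sup>2"
    using c assms by (simp add: u_def power_divide power_mult_distrib) (simp add: power2_eq_square)
  then have "complex_of_real (exp (- u\<^sup>2 / 2)) = gaussian (1 / a) s"
    unfolding gaussian_def by simp
  finally show ?thesis
    using assms by (simp add: scaleR_conv_of_real field_simps)
qed

lemma gaussian_prod: "gaussian a x = (\<Prod>b\<in>Basis. gaussian a (x \<bullet> b))"
proof -
  have "- (pi * a * (norm x)\<^sup>2) = (\<Sum>b\<in>Basis. - (pi * a * (norm (x \<bullet> b))\<^sup>2))"
    unfolding power2_norm_eq_inner[of x] euclidean_inner[of x x]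
    by (simp add: sum_distrib_left sum_negf power2_eq_square)
  then show ?thesis
    unfolding gaussian_def by (simp add: exp_sum)
qed

lemma wave_prod: "wave v x = (\<Prod>b\<in>Basis. iexp (- 2 * pi * ((x \<bullet> b) * (v \<bullet> b))))"
  unfolding wave_def euclidean_inner[of x v] exp_sum[symmetric, OF finite_Basis]
  by (simp add: sum_distrib_left sum_negf)

lemma fourier_gaussian:
  fixes v :: "'a::euclidean_space"
  assumes "a > 0"
  shows "fourier (gaussian a) v = gaussian (1 / a) v / of_real (sqrt a) ^ DIM('a)"
proof -
  let ?g = "\<lambda>b t. iexp (- 2 * pi * (t * (v \<bullet> b))) * gaussian a t"
  have i: "integrable lborel (?g b)" for b
    by (rule Bochner_Integration.integrable_bound[OF schwartz_integrable[OF gaussian_schwartz[OF assms]]])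
      (auto simp: norm_mult)
  have "fourier (gaussian a) v = (LINT x|lborel. (\<Prod>b\<in>Basis. ?g b (x \<bullet> b)))"
    unfolding fourier_wave wave_prod[of v] gaussian_prod[of a "_::'a"] prod.distrib ..
  also have "\<dots> = (\<Prod>b\<in>Basis. (LINT t|lborel. ?g b t))"
    using i by (rule integral_prod_Basis(2))
  also have "\<dots> = (\<Prod>b\<in>Basis. gaussian (1 / a) (v \<bullet> b) / of_real (sqrt a))"
    unfolding gaussian_fourier_real[OF assms] ..
  also have "\<dots> = gaussian (1 / a) v / of_real (sqrt a) ^ DIM('a)"
    by (simp add: prod_dividef gaussian_prod[of _ v])
  finally show ?thesis .
qed

text \<open>The integrand factors over the coordinates. Only the one along \<open>b\<close> sees
  \<open>q\<close>; each of the remaining d - 1 gives the Gaussian integral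
  \<open>1 / sqrt a\<close>, read off from the transform at frequency 0.\<close>

lemma integral_gaussian_slice:
  fixes b :: "'a::euclidean_space" and q :: "real \<Rightarrow> complex"
  assumes "a > 0" "b \<in> Basis" and q: "integrable lborel (\<lambda>t. q t * gaussian a t)"
  shows "integrable lborel (\<lambda>x. q (x \<bullet> b) * gaussian a x)"
    and "(LINT x|lborel. q (x \<bullet> b) * gaussian a x) =
      (LINT t|lborel. q t * gaussian a t) / of_real (sqrt a) ^ (DIM('a) - 1)"
proof -
  let ?g = "\<lambda>c t. (if c = b then q t else 1) * gaussian a t"
  have g1: "integrable lborel (gaussian a :: real \<Rightarrow> complex)"
    using assms by (intro schwartz_integrable gaussian_schwartz)
  have i: "integrable lborel (?g c)" for c
    using q g1 by (cases "c = b") auto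
  have eq: "q (x \<bullet> b) * gaussian a x = (\<Prod>c\<in>Basis. ?g c (x \<bullet> c))" for x
    unfolding gaussian_prod[of a x] prod.distrib using assms(2) by (simp add: prod.delta)
  show "integrable lborel (\<lambda>x. q (x \<bullet> b) * gaussian a x)"
    unfolding eq using i by (rule integral_prod_Basis(1))
  have g0: "(LINT t::real|lborel. gaussian a t) = 1 / of_real (sqrt a)"
    using gaussian_fourier_real[OF assms(1), of 0] by (simp add: gaussian_def)
  have "(LINT x|lborel. q (x \<bullet> b) * gaussian a x) = (\<Prod>c\<in>Basis. (LINT t|lborel. ?g c t))"
    unfolding eq using i by (rule integral_prod_Basis(2))
  also have "\<dots> = (LINT t|lborel. ?g b t) * (\<Prod>c\<in>Basis - {b}. (LINT t|lborel. ?g c t))"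
    using assms(2) by (intro prod.remove) auto
  also have "(\<Prod>c\<in>Basis - {b}. (LINT t|lborel. ?g c t)) = (\<Prod>c\<in>Basis - {b}. 1 / of_real (sqrt a))"
    using g0 by (intro prod.cong) auto
  finally show "(LINT x|lborel. q (x \<bullet> b) * gaussian a x) =
      (LINT t|lborel. q t * gaussian a t) / of_real (sqrt a) ^ (DIM('a) - 1)"
    using assms(2) by (simp add: power_divide card_Diff_singleton)
qed

lemma norm_gaussian_le: "a \<ge> 0 \<Longrightarrow> norm (gaussian a x) \<le> 1"
  by (simp add: gaussian_def)

text \<open>
  A Gaussian factor of width tending to infinity makes the double integral absolutely convergent,
  so that Fubini turns it into the convolution of \<open>\<phi>\<close> with an approximate identity.
\<close>

theorem fourier_inversion:
  fixes \<phi> :: "'a::euclidean_space \<Rightarrow> complex"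
  assumes "\<phi> \<in> schwartz"
  shows "fourier (fourier \<phi>) x = \<phi> (- x)"
proof -
  let ?s = "\<lambda>n. inverse (real (Suc n))"
  \<comment> \<open>The Gaussian parameter is the square of \<open>?s n\<close>, so that the
    transform of the Gaussian has the denominator \<open>?s n ^ d\<close>, exactly the Jacobian of a
    dilation by \<open>?s n\<close>.\<close>
  let ?I = "\<lambda>n. LINT v::'a|lborel. wave x v * (gaussian ((?s n)\<^sup>2) v * fourier \<phi> v)"
  have s: "0 < ?s n" for n
    by simp
  have slim: "?s \<longlonglongrightarrow> 0"
    by (rule LIMSEQ_inverse_real_of_nat)
  have \<phi>m[measurable]: "\<phi> \<in> borel_measurable borel" and \<phi>i: "integrable lborel \<phi>"
    using assms by (auto intro: schwartz_measurable schwartz_integrable)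
  have F: "fourier \<phi> \<in> schwartz"
    using assms by (rule fourier_schwartz)
  have Fm[measurable]: "fourier \<phi> \<in> borel_measurable borel" and Fi: "integrable lborel (fourier \<phi>)"
    using F by (auto intro: schwartz_measurable schwartz_integrable)
  have 1: "?I \<longlonglongrightarrow> fourier (fourier \<phi>) x"
    unfolding fourier_wave[of "fourier \<phi>"]
  proof (rule integral_dominated_convergence)
    show "AE v in lborel. (\<lambda>n. wave x v * (gaussian ((?s n)\<^sup>2) v * fourier \<phi> v)) \<longlonglongrightarrow> wave x v * fourier \<phi> v"
    proof (rule AE_I2)
      fix v :: 'a
      have "(\<lambda>n. gaussian ((?s n)\<^sup>2) v) \<longlonglongrightarrow> of_real (exp (- (pi * 0\<^sup>2 * (norm v)\<^sup>2)))"
        unfolding gaussian_def by (intro tendsto_intros slim)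
      then have "(\<lambda>n. wave x v * (gaussian ((?s n)\<^sup>2) v * fourier \<phi> v)) \<longlonglongrightarrow> wave x v * (1 * fourier \<phi> v)"
        by (intro tendsto_intros) simp
      then show "(\<lambda>n. wave x v * (gaussian ((?s n)\<^sup>2) v * fourier \<phi> v)) \<longlonglongrightarrow> wave x v * fourier \<phi> v"
        by simp
    qed
    show "AE v in lborel. norm (wave x v * (gaussian ((?s n)\<^sup>2) v * fourier \<phi> v)) \<le> norm (fourier \<phi> v)" for n
    proof (rule AE_I2)
      fix v
      show "norm (wave x v * (gaussian ((?s n)\<^sup>2) v * fourier \<phi> v)) \<le> norm (fourier \<phi> v)"
        using mult_right_mono[OF norm_gaussian_le[of "(?s n)\<^sup>2" v], of "norm (fourier \<phi> v)"]
        by (simp add: norm_mult)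
    qed
  qed (use Fi in \<open>auto intro: integrable_norm\<close>)
  have I: "?I n = (LINT w|lborel. \<phi> (- x + ?s n *\<^sub>R w) * gaussian 1 w)" for n
  proof -
    let ?e = "(?s n)\<^sup>2"
    let ?G = "\<lambda>v y. wave x v * gaussian ?e v * (wave v y * \<phi> y)"
    have e: "?e > 0"
      by simp
    have "?I n = (LINT v|lborel. (LINT y|lborel. ?G v y))"
      unfolding fourier_wave[of \<phi>] by (simp add: mult.assoc)
    also have "\<dots> = (LINT y|lborel. (LINT v|lborel. ?G v y))"
    proof (rule lborel_pair.Fubini_integral[symmetric])
      have [measurable]: "(\<lambda>p::'a \<times> 'a. wave (fst p) (snd p)) \<in> borel_measurable borel"
        by (intro borel_measurable_continuous_onI continuous_intros)
      then have [measurable]: "(\<lambda>p::'a \<times> 'a. wave (fst p) (snd p)) \<in> borel_measurable (borel \<Otimes>\<^sub>M borel)"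
        by (simp only: borel_prod)
      have m: "(\<lambda>(v, y). ?G v y) \<in> borel_measurable (lborel \<Otimes>\<^sub>M lborel)"
        unfolding case_prod_beta by measurable
      show "integrable (lborel \<Otimes>\<^sub>M lborel) (\<lambda>(v, y). ?G v y)"
      proof (rule lborel_pair.Fubini_integrable[OF m])
        show "AE v in lborel. integrable lborel (\<lambda>y. (\<lambda>(v, y). ?G v y) (v, y))"
          using \<phi>i by (auto intro!: integrable_wave_mult)
        show "integrable lborel (\<lambda>v. LINT y|lborel. norm ((\<lambda>(v, y). ?G v y) (v, y)))"
          using integrable_norm[OF schwartz_integrable[OF gaussian_schwartz[OF e, where 'a='a]]]
          by (simp add: norm_mult)
      qed
    qed
    also have "\<dots> = (LINT y|lborel. \<phi> y * fourier (gaussian ?e) (x + y))"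
    proof (rule Bochner_Integration.integral_cong[OF refl])
      fix y :: 'a
      have "(LINT v|lborel. ?G v y) = (LINT v|lborel. \<phi> y * (wave (x + y) v * gaussian ?e v))"
        by (intro Bochner_Integration.integral_cong refl)
          (simp add: wave_commute[of _ y] wave_commute[of x] wave_commute[of "x + y"] wave_add)
      then show "(LINT v|lborel. ?G v y) = \<phi> y * fourier (gaussian ?e) (x + y)"
        by (simp add: fourier_wave)
    qed
    also have "\<dots> = (LINT y|lborel. \<phi> y * (gaussian (1 / ?e) (x + y) / of_real (?s n) ^ DIM('a)))"
      unfolding fourier_gaussian[OF e] by simp
    \<comment> \<open>The substitution y = - x + s w makes the Gaussian independent of n and moves
      all dependence on n into the argument of \<phi>, which tends to - x.\<close>
    also have "\<dots> = \<bar>?s n\<bar> ^ DIM('a) *\<^sub>R (LINT w|lborel. \<phi> (- x + ?s n *\<^sub>R w) *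
        (gaussian (1 / ?e) (x + (- x + ?s n *\<^sub>R w)) / of_real (?s n) ^ DIM('a)))"
      by (rule lborel_integral_affine) (use s[of n] in \<open>auto simp del: of_nat_Suc\<close>)
    also have "\<dots> = (LINT w|lborel. \<phi> (- x + ?s n *\<^sub>R w) * gaussian 1 w)"
      unfolding integral_scaleR_right[symmetric]
    proof (rule Bochner_Integration.integral_cong[OF refl])
      fix w :: 'a
      define t where "t = ?s n"
      have "t > 0"
        using s by (simp add: t_def)
      moreover from this have "gaussian (1 / t\<^sup>2) (t *\<^sub>R w) = gaussian 1 w"
        by (simp add: gaussian_def power_mult_distrib)
      ultimately show "\<bar>?s n\<bar> ^ DIM('a) *\<^sub>R (\<phi> (- x + ?s n *\<^sub>R w) *
          (gaussian (1 / ?e) (x + (- x + ?s n *\<^sub>R w)) / of_real (?s n) ^ DIM('a))) =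
          \<phi> (- x + ?s n *\<^sub>R w) * gaussian 1 w"
        unfolding t_def[symmetric] by (simp add: scaleR_conv_of_real)
    qed
    finally show ?thesis .
  qed
  obtain C where C: "\<And>x. norm (\<phi> x) \<le> C"
    using schwartz_rapidly_decreasing[OF assms] unfolding rapidly_decreasing_def
    by (metis mult_1 power_0)
  have G1: "integrable lborel (gaussian 1 :: 'a \<Rightarrow> complex)"
    by (intro schwartz_integrable gaussian_schwartz) simp
  have 2: "?I \<longlonglongrightarrow> (LINT w::'a|lborel. \<phi> (- x) * gaussian 1 w)"
    unfolding I
  proof (rule integral_dominated_convergence)
    show "integrable lborel (\<lambda>w::'a. C * norm (gaussian 1 w))"
      using G1 by simp
    show "AE w in lborel. (\<lambda>n. \<phi> (- x + ?s n *\<^sub>R w) * gaussian 1 w) \<longlonglongrightarrow> \<phi> (- x) * gaussian 1 w"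
    proof (rule AE_I2)
      fix w :: 'a
      have "(\<lambda>n. - x + ?s n *\<^sub>R w) \<longlonglongrightarrow> - x + 0 *\<^sub>R w"
        by (intro tendsto_intros slim)
      then have "(\<lambda>n. \<phi> (- x + ?s n *\<^sub>R w)) \<longlonglongrightarrow> \<phi> (- x)"
        using schwartz_continuous[OF assms, of UNIV]
        by (auto simp: continuous_on_eq_continuous_at intro: isCont_tendsto_compose)
      then show "(\<lambda>n. \<phi> (- x + ?s n *\<^sub>R w) * gaussian 1 w) \<longlonglongrightarrow> \<phi> (- x) * gaussian 1 w"
        by (intro tendsto_intros)
    qed
    show "AE w in lborel. norm (\<phi> (- x + ?s n *\<^sub>R w) * gaussian 1 w) \<le> C * norm (gaussian 1 w)" for n
      using C by (auto simp: norm_mult intro!: mult_right_mono)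
  qed measurable
  have "(LINT w::'a|lborel. gaussian 1 w) = 1"
    using fourier_gaussian[of 1 "0::'a"] by (simp add: fourier_wave wave_def gaussian_def)
  then have "(LINT w::'a|lborel. \<phi> (- x) * gaussian 1 w) = \<phi> (- x)"
    by simp
  with LIMSEQ_unique[OF 1 2] show ?thesis
    by simp
qed

section \<open>Continuity of the Fourier transform and existence of a tempered preimage\<close>

lemma schwartz_diff:
  assumes "\<phi> \<in> schwartz" "\<psi> \<in> schwartz"
  shows "(\<lambda>x. \<phi> x - \<psi> x) \<in> schwartz"
  using schwartz_add[OF assms(1) schwartz_cmult[OF assms(2), of "- 1"]] by simp

lemma iter_partial_diff:
  assumes "\<phi> \<in> schwartz" "\<psi> \<in> schwartz" "set bs \<subseteq> Basis"
  shows "iter_partial bs (\<lambda>x. \<phi> x - \<psi> x) = (\<lambda>x. iter_partial bs \<phi> x - iter_partial bs \<psi> x)"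
  using assms(3)
proof (induction bs)
  case (Cons b bs)
  have d: "iter_partial bs \<phi> differentiable at x" "iter_partial bs \<psi> differentiable at x" for x
    using assms(1,2) Cons.prems unfolding schwartz_def smooth_def by auto
  have "((\<lambda>x. iter_partial bs \<phi> x - iter_partial bs \<psi> x) has_derivative
      (\<lambda>h. frechet_derivative (iter_partial bs \<phi>) (at x) h - frechet_derivative (iter_partial bs \<psi>) (at x) h)) (at x)" for x
    using d unfolding frechet_derivative_works by (rule has_derivative_diff)
  from frechet_derivative_at[OF this, symmetric] show ?case
    unfolding iter_partial_Cons using Cons by simp
qed simp

lemma schwartz_tendsto_weighted:
  fixes \<phi> :: "'a::euclidean_space \<Rightarrow> complex"
  assumes "schwartz_tendsto \<Phi> \<phi>" "set bs \<subseteq> Basis" "range \<Phi> \<subseteq> schwartz" "\<phi> \<in> schwartz" "0 < e"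
  shows "\<forall>\<^sub>F n in sequentially. \<forall>x.
    (1 + norm x ^ m) * norm (iter_partial bs (\<lambda>x. \<Phi> n x - \<phi> x) x) \<le> e"
proof -
  have u: "\<forall>\<^sub>F n in sequentially. \<forall>x. norm x ^ k * norm (iter_partial bs (\<Phi> n) x - iter_partial bs \<phi> x) < e / 2" for k
  proof -
    have "uniform_limit UNIV (\<lambda>n x. norm x ^ k *\<^sub>R iter_partial bs (\<Phi> n) x)
        (\<lambda>x. norm x ^ k *\<^sub>R iter_partial bs \<phi> x) sequentially"
      using assms unfolding schwartz_tendsto_def by blast
    from uniform_limitD[OF this, of "e / 2"] show ?thesis
      using assms(5) by (simp add: dist_norm scaleR_diff_right[symmetric])
  qed
  show ?thesis
    using u[of 0] u[of m]
  proof eventually_elim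
    case (elim n)
    have "\<Phi> n \<in> schwartz"
      using assms(3) by auto
    show ?case
      unfolding iter_partial_diff[OF \<open>\<Phi> n \<in> schwartz\<close> assms(4,2)]
    proof
      fix x
      show "(1 + norm x ^ m) * norm (iter_partial bs (\<Phi> n) x - iter_partial bs \<phi> x) \<le> e"
        using spec[OF elim(1), of x] spec[OF elim(2), of x] by (simp add: distrib_right)
    qed
  qed
qed

lemma weight_mass_nonneg: "0 \<le> weight_mass TYPE('a::euclidean_space)"
  unfolding weight_mass_def by (intro integral_nonneg_AE) (auto intro!: AE_I2)

text \<open>\<open>fourier_decay\<close> is applied to the difference, once with power m and once
  with power 0. It involves only the finitely many partials of order at most m, so their eventual
  bounds hold simultaneously.\<close>

lemma fourier_tendsto_weighted:
  fixes \<phi> :: "'a::euclidean_space \<Rightarrow> complex"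
  assumes "schwartz_tendsto \<Phi> \<phi>" "range \<Phi> \<subseteq> schwartz" "\<phi> \<in> schwartz" "0 < e"
  shows "\<forall>\<^sub>F n in sequentially. \<forall>v. (1 + norm v ^ m) * norm (fourier (\<lambda>x. \<Phi> n x - \<phi> x) v) \<le> e"
proof -
  \<comment> \<open>The sum of the two constants from \<open>fourier_decay\<close>, plus 1 to make
    division by \<open>K\<close> safe.\<close>
  define K where "K = (1 + real DIM('a) ^ m) * weight_mass TYPE('a) + 1"
  have K: "K \<ge> 1"
    unfolding K_def using weight_mass_nonneg[where 'a='a] by simp
  let ?B = "{bs. set bs \<subseteq> (Basis::'a set) \<and> length bs \<le> m}"
  have "finite ?B"
    by (intro finite_lists_length_le) simp
  moreover have "\<forall>bs\<in>?B. \<forall>\<^sub>F n in sequentially. \<forall>x.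
      (1 + norm x ^ (2 * DIM('a))) * norm (iter_partial bs (\<lambda>x. \<Phi> n x - \<phi> x) x) \<le> e / K"
    using assms K by (intro ballI schwartz_tendsto_weighted) auto
  ultimately have "\<forall>\<^sub>F n in sequentially. \<forall>bs\<in>?B. \<forall>x.
      (1 + norm x ^ (2 * DIM('a))) * norm (iter_partial bs (\<lambda>x. \<Phi> n x - \<phi> x) x) \<le> e / K"
    by (rule eventually_ball_finite)
  then show ?thesis
  proof eventually_elim
    case (elim n)
    have s: "(\<lambda>x. \<Phi> n x - \<phi> x) \<in> schwartz"
      using assms by (intro schwartz_diff) auto
    show ?case
    proof
      fix v
      let ?N = "norm (fourier (\<lambda>x. \<Phi> n x - \<phi> x) v)"
      have bd: "(1 + norm x ^ (2 * DIM('a))) * norm (iter_partial bs (\<lambda>x. \<Phi> n x - \<phi> x) x) \<le> e / K"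
        if "set bs \<subseteq> Basis" "length bs \<le> m" for bs x
        using elim that by blast
      have "norm v ^ m * ?N \<le> DIM('a) ^ m * (weight_mass TYPE('a) * (e / K))"
        by (rule fourier_decay[OF s bd])
      moreover have "norm v ^ 0 * ?N \<le> DIM('a) ^ 0 * (weight_mass TYPE('a) * (e / K))"
        by (rule fourier_decay[OF s bd]) auto
      ultimately have "(1 + norm v ^ m) * ?N \<le> (1 + real DIM('a) ^ m) * weight_mass TYPE('a) * (e / K)"
        by (simp add: algebra_simps add_divide_distrib)
      also have "\<dots> \<le> K * (e / K)"
        using assms(4) K by (intro mult_right_mono) (auto simp: K_def)
      also have "\<dots> = e"
        using K by simp
      finally show "(1 + norm v ^ m) * ?N \<le> e" .
    qed
  qed
qed

lemma lebesgue_integral_reflect: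
  fixes f :: "'a::euclidean_space \<Rightarrow> complex"
  assumes [measurable]: "f \<in> borel_measurable lebesgue"
  shows "(LINT x|lebesgue. f (- x)) = (LINT x|lebesgue. f x)"
proof -
  \<comment> \<open>Reflection is the diagonal affine map with all coefficients - 1, whose Jacobian
    is 1.\<close>
  have T: "(\<lambda>x::'a. 0 + (\<Sum>j\<in>Basis. (- 1 * (x \<bullet> j)) *\<^sub>R j)) = uminus"
    by (simp add: sum_negf euclidean_representation fun_eq_iff)
  have 1: "lebesgue = density (distr lebesgue lebesgue (uminus :: 'a \<Rightarrow> 'a)) (\<lambda>_. 1)"
    using lebesgue_affine_euclidean[of "\<lambda>_::'a. - 1" 0] unfolding T by simp
  have [measurable]: "(uminus :: 'a \<Rightarrow> 'a) \<in> lebesgue \<rightarrow>\<^sub>M lebesgue"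
    using lebesgue_affine_measurable[of "\<lambda>_::'a. - 1" 0] unfolding T by simp
  have "(LINT x|lebesgue. f x) = (LINT x|distr lebesgue lebesgue uminus. f x)"
    by (subst 1) (simp add: density_1)
  then show ?thesis
    by (simp add: integral_distr)
qed

text \<open>The substantial point is sequential continuity of the preimage: \<open>T\<close> is
  integrable against some polynomial weight, and transforms of a Schwartz-convergent sequence
  converge uniformly in exactly that weight.\<close>

lemma regular_dist_in_fourier_range:
  fixes T :: "'a::euclidean_space \<Rightarrow> complex"
  assumes T: "slowly_increasing T" and even: "\<And>x. T (- x) = T x"
  shows "regular_dist T \<in> fourier_dist ` tempered"
proof
  let ?S = "\<lambda>\<phi>\<in>schwartz. LINT x|lebesgue. T x * fourier \<phi> x"
  obtain m where m: "integrable lebesgue (\<lambda>x. norm (T x) * inverse (1 + norm x ^ m))"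
    and Tm: "T \<in> borel_measurable lebesgue"
    using slowly_increasing_weight[OF T] by blast
  have int: "integrable lebesgue (\<lambda>x. T x * g x)" if "g \<in> schwartz" for g
    using T that by (intro integrable_slowly_increasing_mult schwartz_rapidly_decreasing schwartz_measurable)
  show "?S \<in> tempered"
    unfolding tempered_def
  proof (intro CollectI conjI ballI allI impI)
    fix \<phi> \<psi> :: "'a \<Rightarrow> complex" assume s: "\<phi> \<in> schwartz" "\<psi> \<in> schwartz"
    show "?S (\<lambda>x. \<phi> x + \<psi> x) = ?S \<phi> + ?S \<psi>"
      using s int[OF fourier_schwartz] by (simp add: schwartz_add fourier_add schwartz_integrable distrib_left)
  next
    fix a and \<phi> :: "'a \<Rightarrow> complex" assume s: "\<phi> \<in> schwartz"
    show "?S (\<lambda>x. a * \<phi> x) = a * ?S \<phi>"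
      using s by (simp add: schwartz_cmult fourier_cmult mult.left_commute[of _ a])
  next
    fix \<Phi> and \<phi> :: "'a \<Rightarrow> complex"
    assume s: "\<phi> \<in> schwartz" "range \<Phi> \<subseteq> schwartz" "schwartz_tendsto \<Phi> \<phi>"
    then have \<Phi>: "\<Phi> n \<in> schwartz" for n
      by auto
    define W where "W = (LINT x|lebesgue. norm (T x) * inverse (1 + norm x ^ m))"
    have "W \<ge> 0"
      unfolding W_def by (intro integral_nonneg_AE) (auto intro!: AE_I2)
    show "(\<lambda>n. ?S (\<Phi> n)) \<longlonglongrightarrow> ?S \<phi>"
    proof (rule tendstoI)
      fix e :: real assume "0 < e"
      then have "0 < e / (W + 1)"
        using \<open>W \<ge> 0\<close> by simp
      from fourier_tendsto_weighted[OF s(3,2,1) this, of m]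
      show "\<forall>\<^sub>F n in sequentially. dist (?S (\<Phi> n)) (?S \<phi>) < e"
      proof eventually_elim
        case (elim n)
        let ?g = "\<lambda>x. \<Phi> n x - \<phi> x"
        have g: "?g \<in> schwartz"
          using \<Phi> s(1) by (rule schwartz_diff)
        have "fourier (\<Phi> n) = fourier (\<lambda>x. ?g x + \<phi> x)"
          by simp
        also have "\<dots> = (\<lambda>v. fourier ?g v + fourier \<phi> v)"
          using g s(1) by (intro fourier_add schwartz_integrable)
        finally have "?S (\<Phi> n) - ?S \<phi> = (LINT x|lebesgue. T x * fourier ?g x)"
          using \<Phi> s(1) int[OF fourier_schwartz[OF g]] int[OF fourier_schwartz[OF s(1)]]
          by (simp add: distrib_left)
        also have "norm \<dots> \<le> e / (W + 1) * W"
          unfolding W_def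
          using elim fourier_schwartz[OF g] schwartz_measurable
          by (intro slowly_increasing_mult_bound[OF m Tm]) (auto simp: W_def)
        also have "\<dots> < e"
          using \<open>0 < e\<close> \<open>W \<ge> 0\<close> by (simp add: field_simps)
        finally show ?case
          by (simp only: dist_norm)
      qed
    qed
  qed auto
  show "regular_dist T = fourier_dist ?S"
    unfolding regular_dist_def fourier_dist_def
  proof (rule restrict_ext)
    fix \<phi> :: "'a \<Rightarrow> complex" assume s: "\<phi> \<in> schwartz"
    have [measurable]: "(\<lambda>x. T x * \<phi> x) \<in> borel_measurable lebesgue"
      using int[OF s] by auto
    have "?S (fourier \<phi>) = (LINT x|lebesgue. T (- x) * \<phi> (- x))"
      using fourier_schwartz[OF s] fourier_inversion[OF s] by (simp add: even)
    also have "\<dots> = (LINT x|lebesgue. T x * \<phi> x)"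
      by (rule lebesgue_integral_reflect) measurable
    finally show "(LINT x|lebesgue. T x * \<phi> x) = ?S (fourier \<phi>)" ..
  qed
qed

section \<open>The hypothesis on F and f tested on Gaussians\<close>

context
  fixes T :: "('a::euclidean_space \<Rightarrow> complex) \<Rightarrow> complex" and g :: "'a \<Rightarrow> complex" and f :: "real \<Rightarrow> complex"
  assumes T: "T \<in> tempered" "fourier_dist T = regular_dist g"
    and f: "fourier_dist (rotation_dual T) = regular_dist f"
begin

text \<open>Rotating the one-dimensional transform of \<open>gaussian a\<close> gives the
  d-dimensional transform of \<open>?c * gaussian a\<close>. Thus \<open>T\<close> is evaluated at a
  Fourier image, where \<open>fourier_dist T = regular_dist g\<close> applies.\<close>

lemma fourier_rotation_gaussian:
  assumes "a > 0"
  shows "(LINT t|lebesgue. f t * gaussian a t) =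
    of_real (sqrt a) ^ (DIM('a) - 1) * (LINT x|lebesgue. g x * gaussian a x)"
proof -
  let ?c = "of_real (sqrt a) ^ (DIM('a) - 1) :: complex"
  have s: "(gaussian a :: real \<Rightarrow> complex) \<in> schwartz" "(gaussian a :: 'a \<Rightarrow> complex) \<in> schwartz"
    using assms by (auto intro: gaussian_schwartz)
  then have cs: "(\<lambda>x::'a. ?c * gaussian a x) \<in> schwartz"
    by (intro schwartz_cmult)
  have pow: "(of_real (sqrt a) :: complex) ^ DIM('a) = of_real (sqrt a) * ?c"
    by (subst power_Suc[symmetric]) simp
  have "rotation (even_part (fourier (gaussian a))) = fourier (\<lambda>x::'a. ?c * gaussian a x)"
    unfolding fourier_cmult
    using assms by (auto simp: fun_eq_iff rotation_def even_part_def fourier_gaussian pow)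
      (simp add: gaussian_def)
  then have "rotation_dual T (fourier (gaussian a)) = T (fourier (\<lambda>x::'a. ?c * gaussian a x))"
    using fourier_schwartz[OF s(1)] by (simp add: rotation_dual_def)
  also have "\<dots> = regular_dist g (\<lambda>x. ?c * gaussian a x)"
    using cs T(2)[THEN fun_cong, of "\<lambda>x. ?c * gaussian a x"] by (simp add: fourier_dist_def)
  also have "\<dots> = ?c * (LINT x|lebesgue. g x * gaussian a x)"
    unfolding integral_mult_right_zero[symmetric] using cs by (simp add: regular_dist_def mult_ac)
  finally show ?thesis
    using f[THEN fun_cong, of "gaussian a"] s(1) by (simp add: fourier_dist_def regular_dist_def)
qed

text \<open>The transform of an odd function is odd, and \<open>even_part\<close> annihilates it, so
  \<open>T\<close> is evaluated at the zero function.\<close>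

lemma fourier_rotation_odd_gaussian:
  assumes "a > 0"
  shows "(LINT t|lebesgue. f t * (of_real t * gaussian a t)) = 0"
proof -
  let ?\<psi> = "\<lambda>t::real. of_real t * gaussian a t"
  have s: "?\<psi> \<in> schwartz"
    using schwartz_coord[OF gaussian_schwartz[OF assms], of "1::real"] by simp
  have F: "fourier ?\<psi> \<in> schwartz"
    using s by (rule fourier_schwartz)
  have "fourier ?\<psi> (- v) = - fourier ?\<psi> v" for v
  proof -
    have "fourier ?\<psi> (- v) = (LINT t|lborel. wave (- v) (0 + (- 1) *\<^sub>R t) * ?\<psi> (0 + (- 1) *\<^sub>R t))"
      unfolding fourier_wave using schwartz_measurable[OF s]
      by (subst lborel_integral_affine[where c = "- 1" and t = 0]) auto
    then show ?thesis
      by (simp add: fourier_wave wave_def gaussian_def)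
  qed
  then have "rotation (even_part (fourier ?\<psi>)) = (\<lambda>x::'a. 0)"
    by (simp add: rotation_def even_part_def fun_eq_iff)
  \<comment> \<open>The zero function is written as a multiple of a Schwartz function so that
    homogeneity of \<open>T\<close> gives the value 0.\<close>
  moreover have "T (\<lambda>x. 0 * gaussian 1 x) = 0 * T (gaussian 1)"
  proof -
    have "T (\<lambda>x. a * \<phi> x) = a * T \<phi>" if "\<phi> \<in> schwartz" for a \<phi>
      using T(1) that unfolding tempered_def by blast
    from this[OF gaussian_schwartz[of 1], of 0] show ?thesis
      by simp
  qed
  ultimately have "rotation_dual T (fourier ?\<psi>) = 0"
    using F by (simp add: rotation_dual_def)
  then show ?thesis
    using f[THEN fun_cong, of ?\<psi>] s by (simp add: fourier_dist_def regular_dist_def)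
qed

end

section \<open>Spherical means and uniqueness\<close>

lemma orthogonal_transformation_measurable:
  fixes Q :: "'a::euclidean_space \<Rightarrow> 'a"
  assumes "orthogonal_transformation Q"
  shows "Q \<in> borel_measurable borel"
  using assms
  by (intro borel_measurable_continuous_onI linear_continuous_on)
    (simp add: orthogonal_transformation_linear linear_conv_bounded_linear[symmetric])

text \<open>
  The uniqueness argument for Haar measure, with the unit ball as reference set: Fubini and
  translation invariance exchange \<open>h\<close> and the indicator of the ball, which \<open>Q\<close> preserves.
\<close>

lemma nn_integral_lborel_orthogonal:
  fixes Q :: "'a::euclidean_space \<Rightarrow> 'a" and h :: "'a \<Rightarrow> ennreal"
  assumes Q: "orthogonal_transformation Q" and [measurable]: "h \<in> borel_measurable borel"
  shows "(\<integral>\<^sup>+x. h (Q x) \<partial>lborel) = (\<integral>\<^sup>+x. h x \<partial>lborel)"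
proof -
  have [measurable]: "Q \<in> borel_measurable borel"
    using Q by (rule orthogonal_transformation_measurable)
  have lin: "linear Q"
    using Q by (rule orthogonal_transformation_linear)
  define P where "P = inv Q"
  have QP: "Q (P y) = y" for y
    unfolding P_def using orthogonal_transformation_surj[OF Q] by (rule surj_f_inv_f)
  let ?B = "indicator (cball 0 1) :: 'a \<Rightarrow> ennreal"
  have [measurable]: "?B \<in> borel_measurable borel"
    by (intro borel_measurable_indicator borel_closed closed_cball)
  have BQ: "?B (Q x) = ?B x" for x
    using orthogonal_transformation_norm[OF Q, of x] by (simp add: indicator_def)
  have shift: "(\<integral>\<^sup>+x. k (t + x) \<partial>lborel) = (\<integral>\<^sup>+x. k x \<partial>lborel)"
    if [measurable]: "k \<in> borel_measurable borel" for k :: "'a \<Rightarrow> ennreal" and t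
  proof -
    have "(\<integral>\<^sup>+x. k x \<partial>lborel) = (\<integral>\<^sup>+x. k x \<partial>distr lborel borel ((+) t))"
      by (simp add: lborel_distr_plus)
    then show ?thesis
      by (simp add: nn_integral_distr)
  qed
  have flip: "(\<integral>\<^sup>+y. h (t - y) \<partial>lborel) = (\<integral>\<^sup>+y. h y \<partial>lborel)" for t
    by (subst (2) lborel_affine[of "- 1" t]) (auto simp: nn_integral_density nn_integral_distr)
  have "(\<integral>\<^sup>+x. h (Q x) \<partial>lborel) * (\<integral>\<^sup>+y. ?B y \<partial>lborel) = (\<integral>\<^sup>+x. h (Q x) * (\<integral>\<^sup>+y. ?B y \<partial>lborel) \<partial>lborel)"
    by (rule nn_integral_multc[symmetric]) measurable
  also have "\<dots> = (\<integral>\<^sup>+x. h (Q x) * (\<integral>\<^sup>+y. ?B (Q x + y) \<partial>lborel) \<partial>lborel)"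
    by (subst shift) auto
  also have "\<dots> = (\<integral>\<^sup>+x. (\<integral>\<^sup>+y. h (Q x) * ?B (Q x + y) \<partial>lborel) \<partial>lborel)"
    by (intro nn_integral_cong nn_integral_cmult[symmetric]) measurable
  also have "\<dots> = (\<integral>\<^sup>+y. (\<integral>\<^sup>+x. h (Q x) * ?B (Q x + y) \<partial>lborel) \<partial>lborel)"
    by (rule lborel_pair.Fubini'[symmetric]) measurable
  also have "\<dots> = (\<integral>\<^sup>+y. (\<integral>\<^sup>+x. h (Q x - y) * ?B x \<partial>lborel) \<partial>lborel)"
  proof (rule nn_integral_cong)
    \<comment> \<open>Translating \<open>x\<close> by a preimage of \<open>- y\<close> replaces
      \<open>Q x\<close> by \<open>Q x - y\<close>; the ball indicator is then evaluated at
      \<open>Q x\<close>, hence equals its value at \<open>x\<close>.\<close>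
    fix y
    have "(\<integral>\<^sup>+x. h (Q x) * ?B (Q x + y) \<partial>lborel) =
        (\<integral>\<^sup>+x. h (Q (P (- y) + x)) * ?B (Q (P (- y) + x) + y) \<partial>lborel)"
      by (rule shift[symmetric]) measurable
    then show "(\<integral>\<^sup>+x. h (Q x) * ?B (Q x + y) \<partial>lborel) = (\<integral>\<^sup>+x. h (Q x - y) * ?B x \<partial>lborel)"
      by (simp add: linear_add[OF lin] QP BQ)
  qed
  also have "\<dots> = (\<integral>\<^sup>+x. (\<integral>\<^sup>+y. h (Q x - y) * ?B x \<partial>lborel) \<partial>lborel)"
    by (rule lborel_pair.Fubini') measurable
  also have "\<dots> = (\<integral>\<^sup>+x. (\<integral>\<^sup>+y. h (Q x - y) \<partial>lborel) * ?B x \<partial>lborel)"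
    by (intro nn_integral_cong nn_integral_multc) measurable
  also have "\<dots> = (\<integral>\<^sup>+x. h x \<partial>lborel) * (\<integral>\<^sup>+y. ?B y \<partial>lborel)"
    unfolding flip by (rule nn_integral_cmult) measurable
  finally have eq: "(\<integral>\<^sup>+x. h (Q x) \<partial>lborel) * emeasure lborel (cball 0 1 :: 'a set) =
      (\<integral>\<^sup>+x. h x \<partial>lborel) * emeasure lborel (cball 0 1 :: 'a set)"
    by simp
  have "emeasure lborel (cball 0 1 :: 'a set) \<noteq> 0"
    using content_cball_pos[of 1 "0::'a"] by (auto simp: measure_def)
  moreover have "emeasure lborel (cball 0 1 :: 'a set) \<noteq> \<infinity>"
    using emeasure_lborel_cball_finite[of "0::'a" 1] by simp
  ultimately show ?thesis
    using eq by (simp add: ennreal_mult_cancel_left mult.commute[of _ "emeasure lborel _"])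
qed

lemma distr_lborel_orthogonal:
  fixes Q :: "'a::euclidean_space \<Rightarrow> 'a"
  assumes "orthogonal_transformation Q"
  shows "distr lborel borel Q = lborel"
proof (rule measure_eqI)
  fix A assume "A \<in> sets (distr lborel borel Q)"
  then have [measurable]: "A \<in> sets borel"
    by simp
  have [measurable]: "Q \<in> borel_measurable borel"
    using assms by (rule orthogonal_transformation_measurable)
  have "emeasure (distr lborel borel Q) A = (\<integral>\<^sup>+x. indicator A x \<partial>distr lborel borel Q)"
    by simp
  also have "\<dots> = (\<integral>\<^sup>+x. indicator A (Q x) \<partial>lborel)"
    by (rule nn_integral_distr) auto
  also have "\<dots> = (\<integral>\<^sup>+x. indicator A x \<partial>lborel)"
    using assms by (rule nn_integral_lborel_orthogonal) measurable
  finally show "emeasure (distr lborel borel Q) A = emeasure lborel A"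
    by simp
qed simp

lemma sets_uniform_sphere: "sets (uniform_sphere :: 'a::euclidean_space measure) = sets (restrict_space borel (sphere 0 1))"
  by (simp add: uniform_sphere_def surface_measure_def)

lemma space_uniform_sphere: "space (uniform_sphere :: 'a::euclidean_space measure) = sphere 0 1"
  using sets_eq_imp_space_eq[OF sets_uniform_sphere] by (simp add: space_restrict_space)

lemma measurable_uniform_sphere:
  "f \<in> borel_measurable borel \<Longrightarrow> f \<in> borel_measurable (uniform_sphere :: 'a::euclidean_space measure)"
  unfolding measurable_cong_sets[OF sets_uniform_sphere refl] by (rule measurable_restrict_space1)

text \<open>The surface measure is defined through cones, and \<open>Q\<close> commutes with
  \<open>sgn\<close> and preserves the norm. The cone over the preimage of \<open>A\<close> is
  therefore the preimage of the cone over \<open>A\<close>, and invariance of \<open>lborel\<close>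
  applies.\<close>

lemma distr_uniform_sphere_orthogonal:
  fixes Q :: "'a::euclidean_space \<Rightarrow> 'a"
  assumes Q: "orthogonal_transformation Q"
  shows "distr uniform_sphere uniform_sphere Q = uniform_sphere"
proof (rule measure_eqI)
  have [measurable]: "Q \<in> borel_measurable borel"
    using Q by (rule orthogonal_transformation_measurable)
  have norm: "norm (Q x) = norm x" for x
    using Q by (rule orthogonal_transformation_norm)
  have Q0: "Q x = 0 \<longleftrightarrow> x = 0" for x
    using norm by (metis norm_eq_zero)
  have sgn: "sgn (Q x) = Q (sgn x)" for x
    by (simp add: sgn_div_norm norm linear_scale[OF orthogonal_transformation_linear[OF Q]])
  have "Q \<in> measurable (restrict_space borel (sphere 0 1)) (restrict_space borel (sphere 0 1))"
    by (intro measurable_restrict_space2 measurable_restrict_space1)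
      (auto simp: space_restrict_space norm)
  then have Qm: "Q \<in> measurable uniform_sphere uniform_sphere"
    unfolding measurable_cong_sets[OF sets_uniform_sphere sets_uniform_sphere] .
  fix A assume "A \<in> sets (distr uniform_sphere uniform_sphere Q)"
  then have A: "A \<in> sets borel" "A \<subseteq> sphere 0 1"
    and A': "A \<in> sets uniform_sphere"
    by (auto simp: sets_uniform_sphere sets_restrict_space_iff)
  have s[measurable]: "sgn \<in> borel_measurable (borel :: 'a measure)"
    unfolding sgn_div_norm[abs_def] by measurable
  define B where "B = {x \<in> ball 0 1 - {0}. sgn x \<in> A}"
  have "B = sgn -` A \<inter> (ball 0 1 - {0})"
    by (auto simp: B_def)
  then have B[measurable]: "B \<in> sets borel"
    using measurable_sets[OF s A(1)] by simp
  define A2 where "A2 = Q -` A \<inter> sphere 0 1"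
  have A2: "A2 \<in> sets borel" "A2 \<subseteq> sphere 0 1"
    unfolding A2_def using measurable_sets[OF \<open>Q \<in> borel_measurable borel\<close> A(1)] by auto
  have "emeasure lborel B = emeasure (distr lborel borel Q) B"
    by (simp add: distr_lborel_orthogonal[OF Q])
  also have "\<dots> = emeasure lborel (Q -` B)"
    by (subst emeasure_distr) auto
  also have "Q -` B = {x \<in> ball 0 1 - {0}. sgn x \<in> A2}"
    by (auto simp: B_def A2_def norm Q0 sgn norm_sgn)
  finally have "emeasure surface_measure A = emeasure surface_measure A2"
    by (simp add: emeasure_surface_measure[OF A] emeasure_surface_measure[OF A2] B_def)
  moreover have "emeasure uniform_sphere X = emeasure surface_measure X / emeasure surface_measure (sphere 0 1 :: 'a set)"
    if "X \<in> sets borel" "X \<subseteq> sphere 0 1" for X :: "'a set"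
    unfolding uniform_sphere_def using that
    by (subst emeasure_uniform_measure)
      (auto simp: surface_measure_def sets_restrict_space_iff Int_absorb1)
  ultimately have "emeasure uniform_sphere A = emeasure uniform_sphere A2"
    using A A2 by simp
  then show "emeasure (distr uniform_sphere uniform_sphere Q) A = emeasure uniform_sphere A"
    by (simp add: emeasure_distr[OF Qm A'] space_uniform_sphere A2_def)
qed simp

lemma integral_uniform_sphere_orthogonal:
  fixes Q :: "'a::euclidean_space \<Rightarrow> 'a" and h :: "'a \<Rightarrow> complex"
  assumes Q: "orthogonal_transformation Q" and h: "h \<in> borel_measurable borel"
  shows "(LINT \<xi>|uniform_sphere. h (Q \<xi>)) = (LINT \<xi>|uniform_sphere. h \<xi>)"
proof -
  have norm: "norm (Q x) = norm x" for x
    using Q by (rule orthogonal_transformation_norm)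
  have "Q \<in> measurable (restrict_space borel (sphere 0 1)) (restrict_space borel (sphere 0 1))"
    by (intro measurable_restrict_space2 measurable_restrict_space1 orthogonal_transformation_measurable Q)
      (auto simp: space_restrict_space norm)
  then have Qm: "Q \<in> measurable uniform_sphere uniform_sphere"
    unfolding measurable_cong_sets[OF sets_uniform_sphere sets_uniform_sphere] .
  have "(LINT \<xi>|uniform_sphere. h \<xi>) = (LINT \<xi>|distr uniform_sphere uniform_sphere Q. h \<xi>)"
    by (simp add: distr_uniform_sphere_orthogonal[OF Q])
  also have "\<dots> = (LINT \<xi>|uniform_sphere. h (Q \<xi>))"
    using h by (intro integral_distr Qm measurable_uniform_sphere)
  finally show ?thesis ..
qed

section \<open>Spherical means: radiality, continuity and Gaussian integrals\<close>

definition sphere_mean :: "(real \<Rightarrow> complex) \<Rightarrow> 'a::euclidean_space \<Rightarrow> complex" where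
  "sphere_mean q x = (LINT \<xi>|uniform_sphere. q (x \<bullet> \<xi>))"

text \<open>The rotation is moved onto \<xi>, whose law is invariant. Together with transitivity of
  orthogonal maps on spheres this makes the mean a radial function of \<open>x\<close>.\<close>

lemma sphere_mean_orthogonal:
  fixes Q :: "'a::euclidean_space \<Rightarrow> 'a"
  assumes Q: "orthogonal_transformation Q" and [measurable]: "q \<in> borel_measurable borel"
  shows "sphere_mean q (Q x) = sphere_mean q x"
proof -
  have "sphere_mean q (Q x) = (LINT \<xi>|uniform_sphere. q (Q x \<bullet> Q \<xi>))"
    unfolding sphere_mean_def by (rule integral_uniform_sphere_orthogonal[OF Q, symmetric]) measurable
  then show ?thesis
    using Q by (simp add: orthogonal_transformation_def sphere_mean_def)
qed

text \<open>Dominated convergence along sequences: a convergent sequence is bounded by some R, so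
  all inner products with unit vectors lie in [-R, R], where \<open>q\<close> is bounded.\<close>

lemma sphere_mean_continuous:
  fixes q :: "real \<Rightarrow> complex"
  assumes q: "continuous_on UNIV q"
  shows "continuous_on UNIV (sphere_mean q :: 'a::euclidean_space \<Rightarrow> complex)"
proof -
  interpret U: prob_space "uniform_sphere :: 'a measure"
    by (rule prob_space_uniform_sphere)
  have qm[measurable]: "q \<in> borel_measurable borel"
    using q by (rule borel_measurable_continuous_onI)
  have "(\<lambda>n. sphere_mean q (X n)) \<longlonglongrightarrow> sphere_mean q x" if X: "X \<longlonglongrightarrow> x" for X :: "nat \<Rightarrow> 'a" and x
  proof -
    obtain R where R: "\<And>n. norm (X n) \<le> R"
      using convergent_imp_Bseq[of X] X unfolding convergent_def Bseq_def by blast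
    have "bounded (q ` {-R..R})"
      by (intro compact_imp_bounded compact_continuous_image continuous_on_subset[OF q]) auto
    then obtain C where C: "\<And>t. t \<in> {-R..R} \<Longrightarrow> norm (q t) \<le> C"
      unfolding bounded_iff ball_simps by blast
    have "(\<lambda>n. LINT \<xi>|uniform_sphere. q (X n \<bullet> \<xi>)) \<longlonglongrightarrow> (LINT \<xi>|uniform_sphere. q (x \<bullet> \<xi>))"
    proof (rule integral_dominated_convergence)
      show "AE \<xi> in uniform_sphere. (\<lambda>n. q (X n \<bullet> \<xi>)) \<longlonglongrightarrow> q (x \<bullet> \<xi>)"
      proof (rule AE_I2)
        fix \<xi>
        have "(\<lambda>n. X n \<bullet> \<xi>) \<longlonglongrightarrow> x \<bullet> \<xi>"
          by (intro tendsto_intros X)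
        then show "(\<lambda>n. q (X n \<bullet> \<xi>)) \<longlonglongrightarrow> q (x \<bullet> \<xi>)"
          using q by (auto simp: continuous_on_eq_continuous_at intro: isCont_tendsto_compose)
      qed
      show "AE \<xi> in uniform_sphere. norm (q (X n \<bullet> \<xi>)) \<le> C" for n
      proof (rule AE_I2)
        fix \<xi> :: 'a assume "\<xi> \<in> space uniform_sphere"
        then have "\<bar>X n \<bullet> \<xi>\<bar> \<le> R"
          using Cauchy_Schwarz_ineq2[of "X n" \<xi>] R[of n] by (simp add: space_uniform_sphere)
        then show "norm (q (X n \<bullet> \<xi>)) \<le> C"
          by (intro C) auto
      qed
    qed (auto intro!: measurable_uniform_sphere)
    then show ?thesis
      by (simp add: sphere_mean_def)
  qed
  then show ?thesis
    by (simp add: continuous_on_eq_continuous_at continuous_at_sequentially o_def)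
qed

text \<open>For fixed \<xi> the integral over x does not depend on \<xi>: a rotation fixing the
  Gaussian takes \<xi> to the basis vector \<open>b\<close>, where the slice formula applies. Fubini
  then averages a constant. The assumption \<open>orth\<close> is transitivity on the unit sphere,
  supplied for \<open>real ^ 'n\<close> in the final theorem.\<close>

lemma sphere_mean_gaussian:
  fixes q :: "real \<Rightarrow> complex" and b :: "'a::euclidean_space"
  assumes q: "continuous_on UNIV q" and a: "a > 0"
    and int: "integrable lborel (\<lambda>t. q t * gaussian a t)"
    and orth: "\<And>\<xi>::'a. norm \<xi> = 1 \<Longrightarrow> \<exists>Q. orthogonal_transformation Q \<and> Q b = \<xi>"
    and b: "b \<in> Basis"
  shows "integrable lborel (\<lambda>x::'a. sphere_mean q x * gaussian a x)"
    and "(LINT x::'a|lborel. sphere_mean q x * gaussian a x) =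
      (LINT t|lborel. q t * gaussian a t) / of_real (sqrt a) ^ (DIM('a) - 1)"
proof -
  interpret U: prob_space "uniform_sphere :: 'a measure"
    by (rule prob_space_uniform_sphere)
  interpret UL: pair_sigma_finite "uniform_sphere :: 'a measure" "lborel :: 'a measure" ..
  have qm[measurable]: "q \<in> borel_measurable borel"
    using q by (rule borel_measurable_continuous_onI)
  let ?f = "\<lambda>\<xi> x::'a. q (x \<bullet> \<xi>) * gaussian a x"
  let ?c = "LINT t|lborel. q t * gaussian a t"
  \<comment> \<open>Stated for an arbitrary \<open>g\<close> because it serves twice: for
    \<open>q\<close> itself, and for the norm of \<open>q\<close> in the integrability condition of
    Fubini.\<close>
  have rot: "integrable lborel (\<lambda>x. g (x \<bullet> \<xi>) * gaussian a x) \<and>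
      (LINT x|lborel. g (x \<bullet> \<xi>) * gaussian a x) =
      (LINT t|lborel. g t * gaussian a t) / of_real (sqrt a) ^ (DIM('a) - 1)"
    if \<xi>: "norm \<xi> = 1" and [measurable]: "g \<in> borel_measurable borel"
      and g: "integrable lborel (\<lambda>t. g t * gaussian a t)" for \<xi> :: 'a and g :: "real \<Rightarrow> complex"
  proof -
    obtain Q where Q: "orthogonal_transformation Q" "Q b = \<xi>"
      using orth[OF \<xi>] by blast
    have [measurable]: "Q \<in> borel_measurable borel"
      using Q(1) by (rule orthogonal_transformation_measurable)
    have eq: "g (Q x \<bullet> \<xi>) * gaussian a (Q x) = g (x \<bullet> b) * gaussian a x" for x
      using Q by (simp add: gaussian_def orthogonal_transformation_norm)
        (metis orthogonal_transformation_def)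
    have m: "(\<lambda>x. g (x \<bullet> \<xi>) * gaussian a x) \<in> borel_measurable borel"
      by measurable
    note D = distr_lborel_orthogonal[OF Q(1)]
    show ?thesis
      using integrable_distr_eq[of Q lborel borel "\<lambda>x. g (x \<bullet> \<xi>) * gaussian a x"]
        integral_distr[of Q lborel borel "\<lambda>x. g (x \<bullet> \<xi>) * gaussian a x"]
        integral_gaussian_slice[OF a b g] m
      by (simp add: D eq)
  qed
  have [measurable]: "(\<lambda>\<xi>::'a. \<xi>) \<in> measurable uniform_sphere borel"
    by (rule measurable_uniform_sphere) simp
  have meas: "case_prod ?f \<in> borel_measurable (uniform_sphere \<Otimes>\<^sub>M lborel)"
  proof -
    have [measurable]: "(fst :: 'a \<times> 'a \<Rightarrow> 'a) \<in> borel_measurable (uniform_sphere \<Otimes>\<^sub>M (lborel :: 'a measure))"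
      using measurable_compose[OF measurable_fst \<open>(\<lambda>\<xi>::'a. \<xi>) \<in> measurable uniform_sphere borel\<close>] .
    show ?thesis
      unfolding case_prod_beta by measurable
  qed
  have nint: "integrable lborel (\<lambda>t. of_real (norm (q t)) * gaussian a t)"
    using integrable_norm[OF int] by (rule Bochner_Integration.integrable_bound) (auto simp: norm_mult)
  have norm_f: "complex_of_real (norm (?f \<xi> x)) = of_real (norm (q (x \<bullet> \<xi>))) * gaussian a x" for \<xi> x
    by (simp add: norm_mult gaussian_def)
  have int2: "integrable (uniform_sphere \<Otimes>\<^sub>M lborel) (case_prod ?f)"
  proof (rule UL.Fubini_integrable[OF meas])
    show "AE \<xi> in uniform_sphere. integrable lborel (\<lambda>y. case_prod ?f (\<xi>, y))"
      using rot[OF _ qm int] by (auto simp: space_uniform_sphere intro!: AE_I2)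
    \<comment> \<open>The slice formula is complex-valued; the real part extracts the common value
      of the integrals of the norms, a constant and so integrable over a probability space.\<close>
    define K where "K = Re ((LINT t|lborel. of_real (norm (q t)) * gaussian a t) / of_real (sqrt a) ^ (DIM('a) - 1))"
    have "(LINT y|lborel. norm (case_prod ?f (\<xi>, y))) = K" if "\<xi> \<in> space uniform_sphere" for \<xi>
    proof -
      have "complex_of_real (LINT y|lborel. norm (?f \<xi> y)) = (LINT y|lborel. complex_of_real (norm (?f \<xi> y)))"
        by simp
      also have "\<dots> = (LINT t|lborel. of_real (norm (q t)) * gaussian a t) / of_real (sqrt a) ^ (DIM('a) - 1)"
        unfolding norm_f
        using rot[of \<xi> "\<lambda>t. of_real (norm (q t))"] nint that by (simp add: space_uniform_sphere)
      finally have "Re (complex_of_real (LINT y|lborel. norm (?f \<xi> y))) = K"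
        unfolding K_def by (rule arg_cong)
      then show ?thesis
        by (simp only: Re_complex_of_real prod.case)
    qed
    then have "integrable uniform_sphere (\<lambda>\<xi>. LINT y|lborel. norm (case_prod ?f (\<xi>, y))) \<longleftrightarrow>
        integrable (uniform_sphere :: 'a measure) (\<lambda>\<xi>. K)"
      by (intro Bochner_Integration.integrable_cong refl)
    then show "integrable uniform_sphere (\<lambda>\<xi>. LINT y|lborel. norm (case_prod ?f (\<xi>, y)))"
      by simp
  qed
  have mean: "sphere_mean q x * gaussian a x = (LINT \<xi>|uniform_sphere. ?f \<xi> x)" for x
    by (simp add: sphere_mean_def)
  show "integrable lborel (\<lambda>x::'a. sphere_mean q x * gaussian a x)"
    unfolding mean using int2 by (rule UL.integrable_snd)
  have "(LINT x::'a|lborel. sphere_mean q x * gaussian a x) = (LINT \<xi>|uniform_sphere. (LINT x|lborel. ?f \<xi> x))"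
    unfolding mean using int2 by (rule UL.Fubini_integral)
  also have "\<dots> = (LINT \<xi>|(uniform_sphere :: 'a measure). ?c / of_real (sqrt a) ^ (DIM('a) - 1))"
    using rot[OF _ qm int] by (intro Bochner_Integration.integral_cong refl) (simp add: space_uniform_sphere)
  also have "\<dots> = ?c / of_real (sqrt a) ^ (DIM('a) - 1)"
    by (simp add: U.prob_space)
  finally show "(LINT x::'a|lborel. sphere_mean q x * gaussian a x) = ?c / of_real (sqrt a) ^ (DIM('a) - 1)" .
qed

section \<open>Uniqueness from vanishing Gaussian integrals\<close>

lemma polynomial_gaussian_integral_zero:
  fixes H :: "'a::euclidean_space \<Rightarrow> complex"
  assumes int: "\<And>a. a > 0 \<Longrightarrow> integrable lebesgue (\<lambda>x. H x * gaussian a x)"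
    and zero: "\<And>a. a > 0 \<Longrightarrow> (LINT x|lebesgue. H x * gaussian a x) = 0"
    and p: "real_polynomial_function p"
  shows "integrable lebesgue (\<lambda>x. of_real (p (exp (- (pi * (norm x)\<^sup>2)))) * (H x * gaussian 1 x))"
    and "(LINT x|lebesgue. of_real (p (exp (- (pi * (norm x)\<^sup>2)))) * (H x * gaussian 1 x)) = 0"
proof -
  obtain c n where p: "p = (\<lambda>t. \<Sum>i\<le>n. c i * t ^ i)"
    using p real_polynomial_function_iff_sum by metis
  \<comment> \<open>Powers of the profile are Gaussians again. The extra factor
    \<open>gaussian 1\<close> shifts the parameter to i + 1, so that also the constant monomial
    corresponds to a positive parameter.\<close>
  have pow: "of_real (exp (- (pi * (norm x)\<^sup>2)) ^ i) * gaussian 1 x = gaussian (real i + 1) x" for i and x :: 'a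
    unfolding gaussian_def exp_of_nat_mult[symmetric] of_real_mult[symmetric] exp_add[symmetric]
    by (simp add: algebra_simps)
  have eq: "of_real (p (exp (- (pi * (norm x)\<^sup>2)))) * (H x * gaussian 1 x) =
      (\<Sum>i\<le>n. of_real (c i) * (H x * gaussian (real i + 1) x))" for x
    unfolding pow[symmetric] p by (simp add: sum_distrib_left sum_distrib_right mult_ac)
  have i: "integrable lebesgue (\<lambda>x. of_real (c i) * (H x * gaussian (real i + 1) x))" for i
    by (intro integrable_mult_right int) simp
  show "integrable lebesgue (\<lambda>x. of_real (p (exp (- (pi * (norm x)\<^sup>2)))) * (H x * gaussian 1 x))"
    unfolding eq using i by (rule Bochner_Integration.integrable_sum)
  show "(LINT x|lebesgue. of_real (p (exp (- (pi * (norm x)\<^sup>2)))) * (H x * gaussian 1 x)) = 0"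
    unfolding eq using i zero[of "real _ + 1"] by (subst Bochner_Integration.integral_sum) auto
qed

text \<open>The profile takes values in [0, 1], so a polynomial uniformly close to \<open>g\<close>
  there changes the integral by at most the error times the L^1 norm of
  \<open>H * gaussian 1\<close>, which is finite thanks to the Gaussian factor.\<close>

lemma continuous_gaussian_integral_zero:
  fixes H :: "'a::euclidean_space \<Rightarrow> complex" and g :: "real \<Rightarrow> real"
  assumes int: "\<And>a. a > 0 \<Longrightarrow> integrable lebesgue (\<lambda>x. H x * gaussian a x)"
    and zero: "\<And>a. a > 0 \<Longrightarrow> (LINT x|lebesgue. H x * gaussian a x) = 0"
    and g: "continuous_on UNIV g"
  shows "integrable lebesgue (\<lambda>x. of_real (g (exp (- (pi * (norm x)\<^sup>2)))) * (H x * gaussian 1 x))"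
    and "(LINT x|lebesgue. of_real (g (exp (- (pi * (norm x)\<^sup>2)))) * (H x * gaussian 1 x)) = 0"
proof -
  let ?u = "\<lambda>x::'a. exp (- (pi * (norm x)\<^sup>2))"
  let ?k = "\<lambda>x. H x * gaussian 1 x"
  have u: "?u x \<in> {0..1}" for x
    by simp
  have k: "integrable lebesgue ?k"
    by (rule int) simp
  have [measurable]: "g \<in> borel_measurable borel"
    using g by (rule borel_measurable_continuous_onI)
  have gu[measurable]: "(\<lambda>x. complex_of_real (g (?u x))) \<in> borel_measurable lebesgue"
    by (rule measurable_completion) measurable
  have km[measurable]: "?k \<in> borel_measurable lebesgue"
    using k by auto
  have "bounded (g ` {0..1})"
    by (intro compact_imp_bounded compact_continuous_image continuous_on_subset[OF g]) auto
  then obtain C where C: "\<And>t. t \<in> {0..1} \<Longrightarrow> norm (g t) \<le> C"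
    unfolding bounded_iff ball_simps by blast
  show i: "integrable lebesgue (\<lambda>x. of_real (g (?u x)) * ?k x)"
  proof (rule Bochner_Integration.integrable_bound)
    show "integrable lebesgue (\<lambda>x. C * norm (?k x))"
      using k by simp
    have "norm (of_real (g (?u x)) * ?k x) \<le> C * norm (?k x)" for x
      unfolding norm_mult[of "of_real _"] norm_of_real
      using C[OF u[of x]] by (intro mult_right_mono) auto
    then show "AE x in lebesgue. norm (of_real (g (?u x)) * ?k x) \<le> norm (C * norm (?k x))"
      by (intro AE_I2) (smt (verit) real_norm_def)
  qed measurable
  define W where "W = (LINT x|lebesgue. norm (?k x))"
  have W: "W \<ge> 0"
    unfolding W_def by (intro integral_nonneg_AE) simp
  have "norm (LINT x|lebesgue. of_real (g (?u x)) * ?k x) \<le> 0 + e" if "e > 0" for e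
  proof -
    have e: "0 < e / (W + 1)"
      using W that by simp
    obtain p where p: "real_polynomial_function p" "\<And>t. t \<in> {0..1} \<Longrightarrow> \<bar>g t - p t\<bar> < e / (W + 1)"
      using Stone_Weierstrass_real_polynomial_function[of "{0..1}" g, OF _ continuous_on_subset[OF g] e] by auto
    note pz = polynomial_gaussian_integral_zero[OF int zero p(1)]
    have "(LINT x|lebesgue. of_real (g (?u x)) * ?k x) =
        (LINT x|lebesgue. of_real (g (?u x)) * ?k x - of_real (p (?u x)) * ?k x)"
      using i pz by (subst Bochner_Integration.integral_diff) auto
    also have "norm \<dots> \<le> (LINT x|lebesgue. e / (W + 1) * norm (?k x))"
    proof (rule Bochner_Integration.integral_norm_bound_integral)
      show "integrable lebesgue (\<lambda>x. of_real (g (?u x)) * ?k x - of_real (p (?u x)) * ?k x)"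
        using i pz(1) by (rule Bochner_Integration.integrable_diff)
      show "integrable lebesgue (\<lambda>x. e / (W + 1) * norm (?k x))"
        using k by simp
      fix x
      have "norm (of_real (g (?u x)) * ?k x - of_real (p (?u x)) * ?k x) = \<bar>g (?u x) - p (?u x)\<bar> * norm (?k x)"
        unfolding left_diff_distrib[symmetric] norm_mult[of _ "?k x"] of_real_diff[symmetric] norm_of_real ..
      also have "\<dots> \<le> e / (W + 1) * norm (?k x)"
        using p(2)[OF u[of x]] by (intro mult_right_mono) auto
      finally show "norm (of_real (g (?u x)) * ?k x - of_real (p (?u x)) * ?k x) \<le> e / (W + 1) * norm (?k x)" .
    qed
    also have "\<dots> = e / (W + 1) * W"
      by (simp add: W_def)
    also have "\<dots> \<le> e"
      using W that by (simp add: field_simps)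
    finally show ?thesis
      by simp
  qed
  then have "norm (LINT x|lebesgue. of_real (g (?u x)) * ?k x) \<le> 0"
    by (rule field_le_epsilon)
  then show "(LINT x|lebesgue. of_real (g (?u x)) * ?k x) = 0"
    by simp
qed

text \<open>The profile is strictly decreasing on the half-line, so closeness of its values forces
  closeness of radii. This lets a bump in the variable of the Weierstrass theorem act as a bump in
  \<open>norm x\<close>.\<close>

lemma gaussian_profile_localizes:
  fixes r d :: real
  assumes "0 \<le> r" "0 < d"
  obtains \<eta> where "\<eta> > 0"
    "\<And>s. 0 \<le> s \<Longrightarrow> \<bar>exp (- (pi * s\<^sup>2)) - exp (- (pi * r\<^sup>2))\<bar> < \<eta> \<Longrightarrow> \<bar>s - r\<bar> < d"
proof -
  let ?e = "\<lambda>s::real. exp (- (pi * s\<^sup>2))"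
  have mono: "?e t \<le> ?e s" if "0 \<le> s" "s \<le> t" for s t
    using that by (simp add: power_mono)
  have smono: "?e t < ?e s" if "0 \<le> s" "s < t" for s t
    using that by (simp add: power_strict_mono)
  \<comment> \<open>The drops of the profile from \<open>r\<close> to either end of the interval. If
    \<open>d > r\<close>, no radius lies to the left of the interval, and 1 is an arbitrary positive
    value.\<close>
  define \<eta> where "\<eta> = min (?e r - ?e (r + d)) (if d \<le> r then ?e (r - d) - ?e r else 1)"
  show thesis
  proof (rule that[of \<eta>])
    show "\<eta> > 0"
      using smono[of r "r + d"] smono[of "r - d" r] assms by (auto simp: \<eta>_def)
    fix s :: real assume s: "0 \<le> s" "\<bar>?e s - ?e r\<bar> < \<eta>"
    show "\<bar>s - r\<bar> < d"
    proof (rule ccontr)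
      assume "\<not> ?thesis"
      then consider "s \<ge> r + d" | "s \<le> r - d" "d \<le> r"
        using s(1) by linarith
      then show False
      proof cases
        case 1
        then have "?e s \<le> ?e (r + d)"
          using assms by (intro mono) auto
        moreover have "\<eta> \<le> ?e r - ?e (r + d)"
          by (simp add: \<eta>_def)
        ultimately show False
          using s(2) by linarith
      next
        case 2
        then have "?e (r - d) \<le> ?e s"
          using s(1) by (intro mono) auto
        moreover have "\<eta> \<le> ?e (r - d) - ?e r"
          using 2 by (simp add: \<eta>_def)
        ultimately show False
          using s(2) by linarith
      qed
    qed
  qed
qed

text \<open>If \<open>h r\<close> were nonzero, multiplication by its conjugate would make the real
  part of \<open>h\<close> positive at all radii near \<open>r\<close>. Integrating against a
  continuous bump supported there gives a nonnegative integrand with integral zero, although it is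
  positive on a nonempty open set.\<close>

lemma radial_gaussian_unique:
  fixes H :: "'a::euclidean_space \<Rightarrow> complex" and h :: "real \<Rightarrow> complex"
  assumes int: "\<And>a. a > 0 \<Longrightarrow> integrable lebesgue (\<lambda>x. H x * gaussian a x)"
    and zero: "\<And>a. a > 0 \<Longrightarrow> (LINT x|lebesgue. H x * gaussian a x) = 0"
    and radial: "\<And>x. H x = h (norm x)"
    and cont: "continuous (at r within {0..}) h" and r: "0 \<le> r"
  shows "h r = 0"
proof (rule ccontr)
  assume "h r \<noteq> 0"
  then have "0 < norm (h r) / 2"
    by simp
  with cont obtain d where d: "0 < d" "\<And>s. 0 \<le> s \<Longrightarrow> \<bar>s - r\<bar> < d \<Longrightarrow> norm (h s - h r) < norm (h r) / 2"
    unfolding continuous_within_eps_delta dist_norm by (metis atLeast_iff real_norm_def)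
  have pos: "0 < Re (cnj (h r) * h s)" if "0 \<le> s" "\<bar>s - r\<bar> < d" for s
  proof -
    have "norm (h s - h r) < norm (h r)"
      using d(2)[OF that] norm_ge_zero[of "h s - h r"] by linarith
    have "\<bar>Re (cnj (h r) * (h s - h r))\<bar> \<le> norm (cnj (h r) * (h s - h r))"
      by (rule abs_Re_le_cmod)
    also have "\<dots> < norm (h r) * norm (h r)"
      using \<open>norm (h s - h r) < norm (h r)\<close> \<open>h r \<noteq> 0\<close> by (simp add: norm_mult)
    also have "norm (h r) * norm (h r) = Re (cnj (h r) * h r)"
      by (simp add: mult.commute[of "cnj _"] complex_mult_cnj cmod_power2 flip: power2_eq_square)
    finally have "\<bar>Re (cnj (h r) * (h s - h r))\<bar> < Re (cnj (h r) * h r)" .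
    then show ?thesis
      by (simp add: right_diff_distrib)
  qed
  obtain \<eta> where \<eta>: "\<eta> > 0"
    "\<And>s. 0 \<le> s \<Longrightarrow> \<bar>exp (- (pi * s\<^sup>2)) - exp (- (pi * r\<^sup>2))\<bar> < \<eta> \<Longrightarrow> \<bar>s - r\<bar> < d"
    using gaussian_profile_localizes[OF r d(1)] by metis
  let ?u = "\<lambda>x::'a. exp (- (pi * (norm x)\<^sup>2))"
  \<comment> \<open>A bump in \<open>u\<close> supported where \<open>Re (cnj (h r) * h)\<close> is positive.\<close>
  define g where "g = (\<lambda>t. max 0 (\<eta> - \<bar>t - exp (- (pi * r\<^sup>2))\<bar>))"
  have "continuous_on UNIV g"
    unfolding g_def by (intro continuous_intros)
  note gz = continuous_gaussian_integral_zero[OF int zero this]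
  let ?I = "\<lambda>x. Re (cnj (h r) * (of_real (g (?u x)) * (H x * gaussian 1 x)))"
  have I: "?I x = g (?u x) * ?u x * Re (cnj (h r) * H x)" for x
  proof -
    have "cnj (h r) * (of_real (g (?u x)) * (H x * gaussian 1 x)) = of_real (g (?u x) * ?u x) * (cnj (h r) * H x)"
      by (simp add: gaussian_def)
    then show ?thesis
      by (simp only: Re_complex_of_real Im_complex_of_real times_complex.sel)
  qed
  have near: "\<bar>norm x - r\<bar> < d" if "g (?u x) \<noteq> 0" for x
    using that \<eta>(2)[of "norm x"] by (auto simp: g_def max_def split: if_splits)
  have nonneg: "0 \<le> ?I x" for x
  proof (cases "g (?u x) = 0")
    case False
    then have "0 < Re (cnj (h r) * H x)"
      unfolding radial by (intro pos near) auto
    moreover have "0 \<le> g (?u x)"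
      by (simp add: g_def)
    ultimately show ?thesis
      unfolding I by (intro mult_nonneg_nonneg) auto
  qed (simp add: I)
  have "integrable lebesgue (\<lambda>x. cnj (h r) * (of_real (g (?u x)) * (H x * gaussian 1 x)))"
    using gz(1) by (rule integrable_mult_right)
  then have iI: "integrable lebesgue ?I"
    by (rule integrable_Re)
  have "integral\<^sup>L lebesgue ?I = Re (LINT x|lebesgue. cnj (h r) * (of_real (g (?u x)) * (H x * gaussian 1 x)))"
    by (rule integral_Re) fact
  also have "\<dots> = 0"
    using gz(2) by simp
  finally have "AE x in lebesgue. ?I x = 0"
    using integral_nonneg_eq_0_iff_AE[OF iI] nonneg by simp
  \<comment> \<open>An open set that contains the sphere of radius \<open>r\<close> and on which the
    integrand is nonzero; it cannot be negligible.\<close>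
  moreover define O' where "O' = {x::'a. \<bar>?u x - exp (- (pi * r\<^sup>2))\<bar> < \<eta>}"
  have "?I x \<noteq> 0" if "x \<in> O'" for x
  proof -
    have "g (?u x) > 0"
      using that by (simp add: O'_def g_def)
    moreover from this have "0 < Re (cnj (h r) * H x)"
      unfolding radial by (intro pos near) auto
    ultimately show ?thesis
      unfolding I by simp
  qed
  ultimately have "AE x in lebesgue. x \<notin> O'"
    by (auto elim: eventually_mono)
  then have "O' \<in> null_sets lebesgue"
    by (subst (asm) AE_iff_null_sets[symmetric])
      (auto simp: O'_def intro!: open_Collect_less continuous_intros)
  then have "negligible O'"
    by (simp add: negligible_iff_null_sets)
  moreover have "open O'"
    unfolding O'_def by (intro open_Collect_less continuous_intros)
  moreover obtain e :: 'a where "norm e = r"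
    using vector_choose_size[OF r] by blast
  then have "e \<in> O'"
    using \<eta>(1) by (simp add: O'_def)
  ultimately show False
    using open_not_negligible by blast
qed

text \<open>Uniqueness in dimension one concerns even functions, so it is applied to the
  symmetrization of \<open>t * f t\<close>. The Gaussian integrals of that function are twice the
  given ones, and its vanishing says \<open>t * (f t - f (- t)) = 0\<close>.\<close>

lemma even_if_odd_gaussian_integrals_zero:
  fixes f :: "real \<Rightarrow> complex"
  assumes "slowly_increasing f" and cont: "continuous_on UNIV f"
    and zero: "\<And>a. a > 0 \<Longrightarrow> (LINT t|lebesgue. f t * (of_real t * gaussian a t)) = 0"
  shows "f (- t) = f t"
proof -
  define h where "h = (\<lambda>t. of_real t * f t + of_real (- t) * f (- t))"
  have h: "h s = 0" if s: "0 \<le> s" for s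
  proof (rule radial_gaussian_unique[where H = h and h = h])
    fix a :: real assume a: "a > 0"
    let ?\<psi> = "\<lambda>t::real. of_real t * gaussian a t"
    have \<psi>: "?\<psi> \<in> schwartz"
      using schwartz_coord[OF gaussian_schwartz[OF a], of "1::real"] by simp
    have i1: "integrable lebesgue (\<lambda>t. f t * ?\<psi> t)"
      using assms(1) \<psi> by (intro integrable_slowly_increasing_mult schwartz_rapidly_decreasing schwartz_measurable)
    have m: "(\<lambda>t. f t * ?\<psi> t) \<in> borel_measurable borel"
      using borel_measurable_continuous_onI[OF cont] schwartz_measurable[OF \<psi>] by measurable
    have "integrable lborel (\<lambda>t. f t * ?\<psi> t)"
      using i1 m by (subst (asm) integrable_completion) auto
    from lborel_integrable_real_affine[OF this, of "- 1" 0]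
    have i2: "integrable lebesgue (\<lambda>t. f (- t) * ?\<psi> (- t))"
      using m by (subst integrable_completion) (auto intro: measurable_compose[OF borel_measurable_uminus])
    have eq: "h t * gaussian a t = f t * ?\<psi> t + f (- t) * ?\<psi> (- t)" for t
      by (simp add: h_def gaussian_def algebra_simps)
    show "integrable lebesgue (\<lambda>x. h x * gaussian a x)"
      unfolding eq using i1 i2 by (rule Bochner_Integration.integrable_add)
    have "(LINT t|lebesgue. h t * gaussian a t) = (LINT t|lebesgue. f t * ?\<psi> t) + (LINT t|lebesgue. f (- t) * ?\<psi> (- t))"
      unfolding eq using i1 i2 by (rule Bochner_Integration.integral_add)
    also have "(LINT t|lebesgue. f (- t) * ?\<psi> (- t)) = (LINT t|lebesgue. f t * ?\<psi> t)"
      using i1 by (intro lebesgue_integral_reflect) auto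
    finally show "(LINT t|lebesgue. h t * gaussian a t) = 0"
      using zero[OF a] by simp
  next
    show "h x = h (norm x)" for x
      by (cases "x \<ge> 0") (simp_all add: h_def add.commute)
    have "continuous_on UNIV h"
      unfolding h_def
      by (intro continuous_intros cont continuous_on_compose2[OF cont]) auto
    then have "isCont h s"
      by (rule continuous_on_interior) simp
    then show "continuous (at s within {0..}) h"
      by (rule continuous_at_imp_continuous_at_within)
  qed (rule s)
  have pos: "f (- s) = f s" if "s > 0" for s
    using h[of s] that by (simp add: h_def flip: right_diff_distrib)
  show ?thesis
    using pos[of t] pos[of "- t"] by (cases t "0::real" rule: linorder_cases) auto
qed

section \<open>Comparison of F with the spherical mean of f\<close>

lemma slowly_increasing_complex:
  fixes g :: "'a::euclidean_space \<Rightarrow> real"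
  assumes "slowly_increasing g"
  shows "slowly_increasing (\<lambda>x. complex_of_real (g x))"
  using assms unfolding slowly_increasing_def locally_integrable_def
  by (auto simp: set_integrable_def scaleR_conv_of_real simp flip: of_real_mult)

theorem theorem4p7:
  fixes F :: "real \<Rightarrow> real" and f :: "real \<Rightarrow> complex" and z :: "real ^ 'n"
  assumes "slowly_increasing (rotation F :: real ^ 'n \<Rightarrow> real)"
    and "slowly_increasing f"
    and "(fourier_dist \<circ> rotation_dual \<circ> inv_fourier_dist)
           (regular_dist (\<lambda>x :: real ^ 'n. complex_of_real (rotation F x))) = regular_dist f"
    and "continuous_on UNIV f"
    and "continuous (at (norm z) within {0..}) F"
  shows "complex_of_real (F (norm z)) =
    prob_space.expectation uniform_sphere (\<lambda>\<xi>. f \<bar>z \<bullet> \<xi>\<bar>)"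
proof -
  let ?RF = "\<lambda>x :: real ^ 'n. complex_of_real (rotation F x)"
  define T where "T = inv_fourier_dist (regular_dist ?RF)"
  have RF: "slowly_increasing ?RF"
    using assms(1) by (rule slowly_increasing_complex)
  \<comment> \<open>\<open>inv_into\<close> yields a genuine preimage only on the range. Whichever
    preimage it selects, the argument relies only on the two facts stated next for
    \<open>T\<close>.\<close>
  have "regular_dist ?RF \<in> fourier_dist ` tempered"
    using RF by (rule regular_dist_in_fourier_range) (simp add: rotation_def)
  then have T: "T \<in> tempered" "fourier_dist T = regular_dist ?RF"
    unfolding T_def inv_fourier_dist_def by (rule inv_into_into, rule f_inv_into_f)
  have f: "fourier_dist (rotation_dual T) = regular_dist f"
    using assms(3) by (simp add: T_def)
  have even: "f (- t) = f t" for t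
    using assms(2,4) fourier_rotation_odd_gaussian[OF T f]
    by (rule even_if_odd_gaussian_integrals_zero)
  have fm: "f \<in> borel_measurable borel"
    using assms(4) by (rule borel_measurable_continuous_onI)
  have orth: "\<exists>Q. orthogonal_transformation Q \<and> Q x = y" if "norm x = norm y" for x y :: "real ^ 'n"
    using orthogonal_transformation_exists[OF that] by metis
  obtain b :: "real ^ 'n" where b: "b \<in> Basis"
    using nonempty_Basis by blast
  \<comment> \<open>The radial profile of the difference: the spherical mean is read off along the
    ray through the unit vector \<open>b\<close>.\<close>
  define h where "h s = complex_of_real (F s) - sphere_mean f (s *\<^sub>R b)" for s
  have "h (norm z) = 0"
  proof (rule radial_gaussian_unique[where H = "\<lambda>x. ?RF x - sphere_mean f x" and h = h])
    fix a :: real assume a: "a > 0"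
    have g: "(gaussian a :: real \<Rightarrow> complex) \<in> schwartz" "(gaussian a :: real ^ 'n \<Rightarrow> complex) \<in> schwartz"
      using a by (auto intro: gaussian_schwartz)
    have i1: "integrable lebesgue (\<lambda>x. ?RF x * gaussian a x)"
      using RF g by (intro integrable_slowly_increasing_mult schwartz_rapidly_decreasing schwartz_measurable)
    have "integrable lebesgue (\<lambda>t. f t * gaussian a t)"
      using assms(2) g by (intro integrable_slowly_increasing_mult schwartz_rapidly_decreasing schwartz_measurable)
    then have fg: "integrable lborel (\<lambda>t. f t * gaussian a t)"
      using fm by (subst (asm) integrable_completion) auto
    have sm[measurable]: "sphere_mean f \<in> borel_measurable (borel :: (real ^ 'n) measure)"
      using sphere_mean_continuous[OF assms(4)] by (rule borel_measurable_continuous_onI)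
    have mean: "integrable lborel (\<lambda>x::real^'n. sphere_mean f x * gaussian a x)"
      "(LINT x::real^'n|lborel. sphere_mean f x * gaussian a x) =
        (LINT t|lborel. f t * gaussian a t) / of_real (sqrt a) ^ (DIM(real^'n) - 1)"
      using sphere_mean_gaussian[OF assms(4) a fg _ b] orth b by auto
    have i2: "integrable lebesgue (\<lambda>x::real^'n. sphere_mean f x * gaussian a x)"
      using mean(1) by (subst integrable_completion) auto
    have eq: "(?RF x - sphere_mean f x) * gaussian a x = ?RF x * gaussian a x - sphere_mean f x * gaussian a x" for x
      by (rule left_diff_distrib)
    show "integrable lebesgue (\<lambda>x. (?RF x - sphere_mean f x) * gaussian a x)"
      unfolding eq using i1 i2 by (rule Bochner_Integration.integrable_diff)
    have "(LINT x::real^'n|lebesgue. sphere_mean f x * gaussian a x) = (LINT x::real^'n|lborel. sphere_mean f x * gaussian a x)"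
      by (rule integral_completion) measurable
    also have "\<dots> = (LINT t|lebesgue. f t * gaussian a t) / of_real (sqrt a) ^ (DIM(real^'n) - 1)"
      using fm by (subst integral_completion) (auto simp: mean(2))
    \<comment> \<open>The factor \<open>sqrt a ^ (d - 1)\<close> from the Fourier side cancels the
      denominator from the slices.\<close>
    also have "\<dots> = (LINT x|lebesgue. ?RF x * gaussian a x)"
      unfolding fourier_rotation_gaussian[OF T f a] using a by simp
    finally show "(LINT x|lebesgue. (?RF x - sphere_mean f x) * gaussian a x) = 0"
      unfolding eq using i1 i2 by (simp add: Bochner_Integration.integral_diff)
  next
    fix x :: "real ^ 'n"
    have "norm (norm x *\<^sub>R b) = norm x"
      using b by simp
    then obtain Q where "orthogonal_transformation Q" "Q (norm x *\<^sub>R b) = x"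
      using orth by blast
    then have "sphere_mean f (norm x *\<^sub>R b) = sphere_mean f x"
      using sphere_mean_orthogonal[of Q f "norm x *\<^sub>R b"] fm by simp
    then show "?RF x - sphere_mean f x = h (norm x)"
      by (simp add: h_def rotation_def)
  next
    have "continuous_on UNIV (\<lambda>s. sphere_mean f (s *\<^sub>R b))"
      by (intro continuous_on_compose2[OF sphere_mean_continuous[OF assms(4)]] continuous_intros) auto
    then have "isCont (\<lambda>s. sphere_mean f (s *\<^sub>R b)) (norm z)"
      by (rule continuous_on_interior) simp
    then have "continuous (at (norm z) within {0..}) (\<lambda>s. sphere_mean f (s *\<^sub>R b))"
      by (rule continuous_at_imp_continuous_at_within)
    then show "continuous (at (norm z) within {0..}) h"
      unfolding h_def using assms(5) by (intro continuous_intros)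
  qed simp
  moreover obtain Q where "orthogonal_transformation Q" "Q (norm z *\<^sub>R b) = z"
    using orth[of "norm z *\<^sub>R b" z] b by auto
  then have "sphere_mean f (norm z *\<^sub>R b) = sphere_mean f z"
    using sphere_mean_orthogonal[of Q f "norm z *\<^sub>R b"] fm by simp
  ultimately have "complex_of_real (F (norm z)) = sphere_mean f z"
    by (simp add: h_def)
  \<comment> \<open>Evenness restores the absolute value in the integrand.\<close>
  also have "f \<bar>t\<bar> = f t" for t
    using even by (simp add: abs_if)
  then have "sphere_mean f z = prob_space.expectation uniform_sphere (\<lambda>\<xi>. f \<bar>z \<bullet> \<xi>\<bar>)"
    by (simp add: sphere_mean_def)
  finally show ?thesis .
qed

end
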